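(* Let $\Phi: X \to \{0,1\}$ be a Boolean function on a set $X$; elements with $\Phi(x)=1$ are called good and the others bad. Let $\delta < \epsilon$. Suppose $C$ is a quantum circuit that uses no measurement and decides $\Phi$ with two-sided exact error $(\delta,\epsilon)$: for every good $x \in X$ the probability of error is exactly $\epsilon$ and for every bad $x$ the probability of error is exactly $\delta$, where success and error are determined by measuring the output state of $C$ (run on the input $x$) with some fixed two-outcome projective measurement. Then there exists a quantum circuit $C'$ that calls $C$ and $C^\dagger$, uses the same input as $C$ (possibly together with additional ancilla qubits), is measured using an extension of the measurement operator of $C$ (i.e., the original measurement tensored with a measurement on the ancillae), and decides $\Phi$ with certainty.
   Context: The input $x$ may be supplied to $C$ either encoded in the initial state (as $\ket{x}$ together with ancillae in a fixed state) or through an oracle gate $U_x:\ket{y,b}\mapsto\ket{y, b\oplus \Phi(y)}$ for $b\in\{0,1\}$; the phrase "uses the same input as $C$" means $C'$ receives $x$ in the same way. A two-outcome projective measurement is a pair $\langle P_E, I-P_E\rangle$ with $P_E$ a projector.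
   Formalization: If "error" means the wrong answer (different outcomes on good and bad inputs), δ + ε ≠ 1 is also assumed: otherwise a circuit that ignores its input and accepts with probability δ meets the hypotheses for every Φ. If error is one fixed outcome, nothing is added. *)

theory Defs
  imports Complex_Main "Jordan_Normal_Form.Schur_Decomposition"
begin

text \<open>A register of \<open>k\<close> qubits is the space of complex vectors of dimension \<open>2 ^ k\<close>; basis states
  are numbered in binary, so the index of a product basis state is \<open>i * d + j\<close>, where \<open>d\<close> is the
  dimension of the right factor.\<close>

definition kron_vec :: "complex vec \<Rightarrow> complex vec \<Rightarrow> complex vec" where
  "kron_vec u v = vec (dim_vec u * dim_vec v)
     (\<lambda>i. u $ (i div dim_vec v) * v $ (i mod dim_vec v))"

definition kron_mat :: "complex mat \<Rightarrow> complex mat \<Rightarrow> complex mat" where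
  "kron_mat A B = mat (dim_row A * dim_row B) (dim_col A * dim_col B)
     (\<lambda>(i, j). A $$ (i div dim_row B, j div dim_col B) * B $$ (i mod dim_row B, j mod dim_col B))"

definition unitary_mat :: "nat \<Rightarrow> complex mat \<Rightarrow> bool" where
  "unitary_mat d U \<longleftrightarrow> U \<in> carrier_mat d d \<and> U * mat_adjoint U = 1\<^sub>m d \<and> mat_adjoint U * U = 1\<^sub>m d"

definition projector :: "nat \<Rightarrow> complex mat \<Rightarrow> bool" where
  "projector d P \<longleftrightarrow> P \<in> carrier_mat d d \<and> P * P = P \<and> mat_adjoint P = P"

definition state :: "nat \<Rightarrow> complex vec \<Rightarrow> bool" where
  "state d v \<longleftrightarrow> v \<in> carrier_vec d \<and> v \<bullet>c v = 1"

text \<open>The squared norm of the projected state.\<close>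

definition outcome_prob :: "complex mat \<Rightarrow> complex vec \<Rightarrow> real" where
  "outcome_prob P v = Re ((P *\<^sub>v v) \<bullet>c (P *\<^sub>v v))"

text \<open>The two outcomes of the measurement given by a projector \<open>P\<close> and its complement.\<close>

definition outcomes :: "nat \<Rightarrow> complex mat \<Rightarrow> complex mat set" where
  "outcomes d P = {P, 1\<^sub>m d - P}"

text \<open>How the input \<open>x\<close> reaches a circuit. \<open>Encoded m enc\<close>: the first \<open>m\<close> qubits start in the basis
  state numbered \<open>enc x\<close>. \<open>Oracle q f\<close>: the circuit may query the bit function \<open>f x\<close> of \<open>q\<close>-bit
  arguments, and the initial state does not depend on \<open>x\<close>.\<close>

datatype 'x input_model = Encoded nat "'x \<Rightarrow> nat" | Oracle nat "'x \<Rightarrow> nat \<Rightarrow> bool"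

text \<open>\<open>\<phi>\<close> is the fixed state of all qubits that do not carry the encoded input.\<close>

fun valid_input :: "nat \<Rightarrow> 'x set \<Rightarrow> 'x input_model \<Rightarrow> complex vec \<Rightarrow> bool" where
  "valid_input n X (Encoded m enc) \<phi> \<longleftrightarrow>
     m \<le> n \<and> inj_on enc X \<and> enc ` X \<subseteq> {..<2 ^ m} \<and> state (2 ^ (n - m)) \<phi>"
| "valid_input n X (Oracle q f) \<phi> \<longleftrightarrow> q + 1 \<le> n \<and> state (2 ^ n) \<phi>"

fun initial_state :: "'x input_model \<Rightarrow> complex vec \<Rightarrow> 'x \<Rightarrow> complex vec" where
  "initial_state (Encoded m enc) \<phi> x = kron_vec (unit_vec (2 ^ m) (enc x)) \<phi>"
| "initial_state (Oracle q f) \<phi> x = \<phi>"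

text \<open>The map sending the basis state \<open>y, b\<close> to \<open>y, b \<oplus> g y\<close>, with \<open>y, b\<close> numbered \<open>2 * y + b\<close>.\<close>

definition oracle_mat :: "nat \<Rightarrow> (nat \<Rightarrow> bool) \<Rightarrow> complex mat" where
  "oracle_mat q g = mat (2 ^ (q + 1)) (2 ^ (q + 1))
     (\<lambda>(i, j). if i div 2 = j div 2 \<and> i mod 2 = (j mod 2 + of_bool (g (j div 2))) mod 2
               then 1 else 0)"

text \<open>The circuit \<open>C\<close>: measurement-free, its gates are unitaries not depending on the input, and oracle
  queries if the input is supplied by an oracle. A query acts on the leading qubits; this is no
  restriction because the qubits may be permuted by the other gates.\<close>

datatype gate = Gate "complex mat" | Query

fun valid_gate :: "nat \<Rightarrow> 'x input_model \<Rightarrow> gate \<Rightarrow> bool" where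
  "valid_gate n s (Gate U) \<longleftrightarrow> unitary_mat (2 ^ n) U"
| "valid_gate n (Encoded m enc) Query \<longleftrightarrow> False"
| "valid_gate n (Oracle q f) Query \<longleftrightarrow> True"

fun gate_mat :: "nat \<Rightarrow> 'x input_model \<Rightarrow> 'x \<Rightarrow> gate \<Rightarrow> complex mat" where
  "gate_mat n s x (Gate U) = U"
| "gate_mat n (Oracle q f) x Query = kron_mat (oracle_mat q (f x)) (1\<^sub>m (2 ^ (n - (q + 1))))"
| "gate_mat n (Encoded m enc) x Query = 1\<^sub>m (2 ^ n)"

text \<open>The first matrix of the list is applied first.\<close>

fun compose_mats :: "nat \<Rightarrow> complex mat list \<Rightarrow> complex mat" where
  "compose_mats d [] = 1\<^sub>m d"
| "compose_mats d (A # As) = compose_mats d As * A"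

definition circuit_mat :: "nat \<Rightarrow> 'x input_model \<Rightarrow> gate list \<Rightarrow> 'x \<Rightarrow> complex mat" where
  "circuit_mat n s C x = compose_mats (2 ^ n) (map (gate_mat n s x) C)"

definition circuit_output :: "nat \<Rightarrow> 'x input_model \<Rightarrow> complex vec \<Rightarrow> gate list \<Rightarrow> 'x \<Rightarrow> complex vec" where
  "circuit_output n s \<phi> C x = circuit_mat n s C x *\<^sub>v initial_state s \<phi> x"

text \<open>The circuit \<open>C'\<close> works on the \<open>n\<close> qubits of \<open>C\<close> and \<open>a\<close> further ancillae. It has access to an
  oracle only by calling \<open>C\<close> and its adjoint, which act on the first \<open>n\<close> qubits.\<close>

datatype call_gate = Plain "complex mat" | Call | Call_adjoint

fun valid_call_gate :: "nat \<Rightarrow> call_gate \<Rightarrow> bool" where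
  "valid_call_gate k (Plain U) \<longleftrightarrow> unitary_mat (2 ^ k) U"
| "valid_call_gate k Call \<longleftrightarrow> True"
| "valid_call_gate k Call_adjoint \<longleftrightarrow> True"

fun call_gate_mat :: "nat \<Rightarrow> complex mat \<Rightarrow> call_gate \<Rightarrow> complex mat" where
  "call_gate_mat a V (Plain U) = U"
| "call_gate_mat a V Call = kron_mat V (1\<^sub>m (2 ^ a))"
| "call_gate_mat a V Call_adjoint = kron_mat (mat_adjoint V) (1\<^sub>m (2 ^ a))"

definition calling_output ::
  "nat \<Rightarrow> nat \<Rightarrow> 'x input_model \<Rightarrow> complex vec \<Rightarrow> gate list \<Rightarrow> call_gate list \<Rightarrow> 'x \<Rightarrow> complex vec" where
  "calling_output n a s \<phi> C C' x =
     compose_mats (2 ^ (n + a)) (map (call_gate_mat a (circuit_mat n s C x)) C') *\<^sub>v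
     kron_vec (initial_state s \<phi> x) (unit_vec (2 ^ a) 0)"

text \<open>\<open>Eg\<close> and \<open>Eb\<close> are the outcomes that count as an error on good and on bad inputs.\<close>

definition two_sided_exact_error ::
  "('x \<Rightarrow> complex vec) \<Rightarrow> 'x set \<Rightarrow> ('x \<Rightarrow> bool) \<Rightarrow> complex mat \<Rightarrow> complex mat \<Rightarrow> real \<Rightarrow> real \<Rightarrow> bool"
where
  "two_sided_exact_error out X \<Phi> Eg Eb \<delta> \<epsilon> \<longleftrightarrow>
     (\<forall>x\<in>X. \<Phi> x \<longrightarrow> outcome_prob Eg (out x) = \<epsilon>) \<and>
     (\<forall>x\<in>X. \<not> \<Phi> x \<longrightarrow> outcome_prob Eb (out x) = \<delta>)"

text \<open>\<open>A\<close> is the accepting outcome.\<close>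

definition decides_with_certainty ::
  "('x \<Rightarrow> complex vec) \<Rightarrow> 'x set \<Rightarrow> ('x \<Rightarrow> bool) \<Rightarrow> complex mat \<Rightarrow> bool" where
  "decides_with_certainty out X \<Phi> A \<longleftrightarrow>
     (\<forall>x\<in>X. outcome_prob A (out x) = (if \<Phi> x then 1 else 0))"

end

theory Submission
  imports Defs "HOL-Combinatorics.Transposition"
begin

text \<open>
  Let \<open>w = V \<xi>\<close> be the output of the circuit and \<open>p\<close> the probability of the outcome \<open>R\<close>. Multiplying
  the range of \<open>R\<close> by a phase \<open>\<alpha>\<close> and then the ray of \<open>w\<close> by a phase \<open>\<beta>\<close> turns \<open>R w\<close> into
  \<open>(\<alpha> - (1 - \<beta>) (1 - (1 - \<alpha>) p)) R w\<close>; the second phase is \<open>V\<close> times a phase on the initial state times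
  the adjoint of \<open>V\<close>. Here \<open>p\<close> takes only two known values, one on good and one on bad inputs.

  If \<open>p \<le> 3/4\<close>, suitable phases annihilate the coefficient at \<open>p\<close> and at no other probability; if
  both values exceed \<open>3/4\<close>, pass to the complementary outcome. This makes one value \<open>0\<close>, where it stays.
  With \<open>\<alpha> = \<beta> = -1\<close> the other value \<open>r\<close> becomes \<open>(3 - 4 r)\<^sup>2 r \<ge> 4 r\<close> as long as \<open>r \<le> 1/4\<close>, and once
  \<open>r \<ge> 1/4\<close> suitable phases annihilate the complementary component, so that the value becomes \<open>1\<close>.

  The initial state depends on an encoded input, so a phase on it is not a fixed gate. A copy of the
  input is therefore kept in ancillae: on the ancilla state \<open>y\<close>, the projector onto the span of all
  \<open>\<xi>\<^sub>y \<otimes> e\<^sub>y\<close> acts as the projector onto the ray of \<open>\<xi>\<^sub>y\<close>.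
\<close>

subsection \<open>Unitaries, projectors and phases\<close>

text \<open>A product basis index is packed as \<open>a * q + b\<close>. The coordinate computations
  with Kronecker products below split their sums in this way and then factor them.\<close>

lemma sum_lessThan_div_mod:
  fixes f :: "nat \<Rightarrow> nat \<Rightarrow> 'a::comm_monoid_add"
  shows "(\<Sum>i<p * q. f (i div q) (i mod q)) = (\<Sum>a<p. \<Sum>b<q. f a b)"
proof (cases "q = 0")
  case False
  have "(\<Sum>i<p * q. f (i div q) (i mod q)) = (\<Sum>(a, b)\<in>{..<p} \<times> {..<q}. f a b)"
  proof (rule sum.reindex_bij_witness[of _ "\<lambda>(a, b). a * q + b" "\<lambda>i. (i div q, i mod q)"])
    fix ab assume "ab \<in> {..<p} \<times> {..<q}"
    then obtain a b where ab: "ab = (a, b)" "a < p" "b < q" by auto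
    have "a * q + b < (a + 1) * q" using ab by simp
    also have "\<dots> \<le> p * q" using ab by (intro mult_right_mono) auto
    finally show "(case ab of (a, b) \<Rightarrow> a * q + b) \<in> {..<p * q}" using ab by simp
  qed (use False in \<open>auto simp: less_mult_imp_div_less\<close>)
  then show ?thesis by (simp add: sum.cartesian_product)
qed simp

section \<open>Inner products, matrix products and adjoints in coordinates\<close>

lemma cscalar_prod_sum: "dim_vec w = d \<Longrightarrow> (v :: complex vec) \<bullet>c w = (\<Sum>i<d. v $ i * cnj (w $ i))"
  by (auto simp: scalar_prod_def lessThan_atLeast0 intro!: sum.cong)

lemma mult_mat_vec_sum:
  "dim_vec v = d \<Longrightarrow> i < dim_row A \<Longrightarrow> dim_col A = d \<Longrightarrow> (A *\<^sub>v v) $ i = (\<Sum>j<d. A $$ (i, j) * v $ j)"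
  by (auto simp: scalar_prod_def lessThan_atLeast0 intro!: sum.cong)

lemma mult_mat_sum:
  "i < dim_row A \<Longrightarrow> j < dim_col B \<Longrightarrow> dim_col A = d \<Longrightarrow> dim_row B = d \<Longrightarrow>
    (A * B) $$ (i, j) = (\<Sum>k<d. A $$ (i, k) * B $$ (k, j))"
  by (auto simp: scalar_prod_def lessThan_atLeast0 intro!: sum.cong)

lemma mat_adjoint_dim [simp]:
  "dim_row (mat_adjoint A) = dim_col A" "dim_col (mat_adjoint A) = dim_row A"
  by (auto simp: mat_adjoint_def)

lemma mat_adjoint_carrier [simp]: "A \<in> carrier_mat r c \<Longrightarrow> mat_adjoint A \<in> carrier_mat c r"
  by (intro carrier_matI) auto

lemma mat_adjoint_index [simp]:
  "i < dim_col A \<Longrightarrow> j < dim_row A \<Longrightarrow> mat_adjoint (A :: complex mat) $$ (i, j) = cnj (A $$ (j, i))"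
  by (simp add: mat_adjoint_def mat_of_rows_def)

lemma mat_adjoint_adjoint [simp]: "mat_adjoint (mat_adjoint A) = (A :: complex mat)"
  by (rule eq_matI) auto

lemma mat_adjoint_mult:
  assumes "A \<in> carrier_mat r d" "B \<in> carrier_mat d c"
  shows "mat_adjoint (A * B) = mat_adjoint B * mat_adjoint (A :: complex mat)"
proof (rule eq_matI)
  fix i j assume "i < dim_row (mat_adjoint B * mat_adjoint A)" "j < dim_col (mat_adjoint B * mat_adjoint A)"
  then show "mat_adjoint (A * B) $$ (i, j) = (mat_adjoint B * mat_adjoint A) $$ (i, j)"
    using assms by (auto simp: mult_mat_sum[where d = d] mult.commute simp del: index_mult_mat(1) intro!: sum.cong)
qed (use assms in auto)

lemma cscalar_prod_mat_adjoint:
  assumes "A \<in> carrier_mat d d" "u \<in> carrier_vec d" "v \<in> carrier_vec d"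
  shows "((A :: complex mat) *\<^sub>v u) \<bullet>c v = u \<bullet>c (mat_adjoint A *\<^sub>v v)"
proof -
  have "(A *\<^sub>v u) \<bullet>c v = (\<Sum>i<d. \<Sum>j<d. A $$ (i, j) * u $ j * cnj (v $ i))"
    using assms by (simp add: cscalar_prod_sum[where d = d] mult_mat_vec_sum[where d = d] sum_distrib_right
        del: index_mult_mat_vec)
  also have "\<dots> = (\<Sum>j<d. \<Sum>i<d. A $$ (i, j) * u $ j * cnj (v $ i))" by (rule sum.swap)
  also have "\<dots> = u \<bullet>c (mat_adjoint A *\<^sub>v v)"
    using assms by (simp add: cscalar_prod_sum[where d = d] mult_mat_vec_sum[where d = d] sum_distrib_left
        mult_ac del: index_mult_mat_vec)
  finally show ?thesis .
qed

section \<open>Unitary matrices\<close>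

lemma unitary_mat_carrier: "unitary_mat d U \<Longrightarrow> U \<in> carrier_mat d d"
  by (simp add: unitary_mat_def)

lemma unitary_mat_adjoint: "unitary_mat d U \<Longrightarrow> unitary_mat d (mat_adjoint U)"
  by (auto simp: unitary_mat_def)

lemma unitary_mat_mult:
  assumes U: "unitary_mat d U" and V: "unitary_mat d V"
  shows "unitary_mat d (U * V)"
proof -
  have c: "U \<in> carrier_mat d d" "V \<in> carrier_mat d d"
    "mat_adjoint U \<in> carrier_mat d d" "mat_adjoint V \<in> carrier_mat d d"
    using U V by (auto simp: unitary_mat_def)
  have collapse: "A * B * (B' * A') = 1\<^sub>m d"
    if "A \<in> carrier_mat d d" "B \<in> carrier_mat d d" "B' \<in> carrier_mat d d" "A' \<in> carrier_mat d d"
      and "B * B' = 1\<^sub>m d" "A * A' = 1\<^sub>m d" for A B A' B' :: "complex mat"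
  proof -
    have "A * B * (B' * A') = A * (B * (B' * A'))"
      by (rule assoc_mult_mat) (use that in auto)
    also have "B * (B' * A') = B * B' * A'"
      by (rule assoc_mult_mat[symmetric]) (use that in auto)
    finally show ?thesis using that by simp
  qed
  have adj: "mat_adjoint (U * V) = mat_adjoint V * mat_adjoint U"
    by (rule mat_adjoint_mult[OF c(1,2)])
  show ?thesis
    using c U V collapse[of U V "mat_adjoint V" "mat_adjoint U"]
      collapse[of "mat_adjoint V" "mat_adjoint U" U V]
    by (auto simp: unitary_mat_def adj)
qed

lemma unitary_mat_one: "unitary_mat d (1\<^sub>m d)"
proof -
  have "mat_adjoint (1\<^sub>m d) = (1\<^sub>m d :: complex mat)" by (rule eq_matI) auto
  then show ?thesis by (simp add: unitary_mat_def)
qed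

text \<open>The permutation matrix of an involution is symmetric, hence self-adjoint and its own
  inverse. Both the oracle and the copying of the input are of this kind.\<close>

lemma unitary_mat_involution:
  assumes "\<And>i. i < d \<Longrightarrow> \<sigma> i < d" "\<And>i. i < d \<Longrightarrow> \<sigma> (\<sigma> i) = i"
  shows "unitary_mat d (mat d d (\<lambda>(i, j). of_bool (i = \<sigma> j)))" (is "unitary_mat d ?K")
proof -
  have iff: "i = \<sigma> j \<longleftrightarrow> j = \<sigma> i" if "i < d" "j < d" for i j
    using assms that by metis
  have adj: "mat_adjoint ?K = ?K" using iff by (intro eq_matI) auto
  have "?K * ?K = 1\<^sub>m d"
  proof (rule eq_matI)
    fix i j assume ij: "i < dim_row (1\<^sub>m d :: complex mat)" "j < dim_col (1\<^sub>m d :: complex mat)"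
    have "(?K * ?K) $$ (i, j) = (\<Sum>k<d. of_bool (i = \<sigma> k) * of_bool (k = \<sigma> j))"
      using ij by (subst mult_mat_sum[where d = d]) auto
    also have "\<dots> = (\<Sum>k<d. if k = \<sigma> j then of_bool (i = \<sigma> k) else 0)"
      by (intro sum.cong) auto
    also have "\<dots> = (1\<^sub>m d) $$ (i, j)" using ij assms by simp
    finally show "(?K * ?K) $$ (i, j) = (1\<^sub>m d) $$ (i, j)" .
  qed auto
  then show ?thesis unfolding unitary_mat_def adj by simp
qed

lemma unitary_mat_state:
  assumes "unitary_mat d U" "state d v"
  shows "state d (U *\<^sub>v v)"
proof -
  have c: "U \<in> carrier_mat d d" "mat_adjoint U \<in> carrier_mat d d" "v \<in> carrier_vec d"
    using assms unitary_mat_carrier by (auto simp: state_def)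
  then have "(U *\<^sub>v v) \<bullet>c (U *\<^sub>v v) = v \<bullet>c (mat_adjoint U *\<^sub>v (U *\<^sub>v v))"
    by (simp add: cscalar_prod_mat_adjoint)
  also have "mat_adjoint U *\<^sub>v (U *\<^sub>v v) = (mat_adjoint U * U) *\<^sub>v v"
    by (rule assoc_mult_mat_vec[symmetric, OF c(2,1,3)])
  also have "\<dots> = v" using assms c by (simp add: unitary_mat_def)
  finally show ?thesis using assms c by (simp add: state_def)
qed

section \<open>Projectors and outcome probabilities\<close>

lemma projector_carrier: "projector d P \<Longrightarrow> P \<in> carrier_mat d d"
  by (simp add: projector_def)

lemma projector_apply_twice:
  "projector d P \<Longrightarrow> v \<in> carrier_vec d \<Longrightarrow> P *\<^sub>v (P *\<^sub>v v) = P *\<^sub>v v"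
  using assoc_mult_mat_vec[of P d d P d v] by (simp add: projector_def)

lemma projector_one: "projector d (1\<^sub>m d)"
proof -
  have "mat_adjoint (1\<^sub>m d) = (1\<^sub>m d :: complex mat)" by (rule eq_matI) auto
  then show ?thesis by (simp add: projector_def)
qed

lemma projector_complement:
  assumes "projector d P"
  shows "projector d (1\<^sub>m d - P)"
proof -
  have c: "P \<in> carrier_mat d d" and PP: "P * P = P" and adj: "mat_adjoint P = P"
    using assms by (auto simp: projector_def)
  have "(1\<^sub>m d - P) * (1\<^sub>m d - P) = (1\<^sub>m d - P) - (P - P)"
    using c by (subst mult_minus_distrib_mat[of _ d d _ d])
      (auto simp: minus_mult_distrib_mat[of _ d d _ _ d] PP minus_carrier_mat
        right_mult_one_mat[of _ d d] left_mult_one_mat[of _ d d])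
  also have "\<dots> = 1\<^sub>m d - P" by (rule eq_matI) (use c in auto)
  moreover have "mat_adjoint (1\<^sub>m d - P) = 1\<^sub>m d - P"
  proof (rule eq_matI)
    fix i j assume ij: "i < dim_row (1\<^sub>m d - P)" "j < dim_col (1\<^sub>m d - P)"
    then have "cnj (P $$ (j, i)) = P $$ (i, j)"
      using c mat_adjoint_index[of i P j] by (simp add: adj)
    then show "mat_adjoint (1\<^sub>m d - P) $$ (i, j) = (1\<^sub>m d - P) $$ (i, j)"
      using ij c by auto
  qed (use c in auto)
  ultimately show ?thesis using c by (simp add: projector_def minus_carrier_mat)
qed

lemma outcome_prob_projector:
  assumes "projector d P" "v \<in> carrier_vec d"
  shows "(P *\<^sub>v v) \<bullet>c v = of_real (outcome_prob P v)" "(P *\<^sub>v v) \<bullet>c (P *\<^sub>v v) = of_real (outcome_prob P v)"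
    "0 \<le> outcome_prob P v"
proof -
  have c: "P *\<^sub>v v \<in> carrier_vec d"
    using mult_mat_vec_carrier[OF projector_carrier] assms by blast
  \<comment> \<open>For a complex number \<open>0 \<le> z\<close> also says that \<open>z\<close> is
    real, which removes the \<open>Re\<close> of \<open>outcome_prob\<close>.\<close>
  have "0 \<le> (P *\<^sub>v v) \<bullet>c (P *\<^sub>v v)" by (rule conjugate_square_ge_0_vec)
  then show 1: "(P *\<^sub>v v) \<bullet>c (P *\<^sub>v v) = of_real (outcome_prob P v)" "0 \<le> outcome_prob P v"
    by (auto simp: outcome_prob_def less_eq_complex_def complex_eq_iff)
  have "(P *\<^sub>v v) \<bullet>c v = (P *\<^sub>v (P *\<^sub>v v)) \<bullet>c v" using assms by (simp add: projector_apply_twice)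
  also have "\<dots> = (P *\<^sub>v v) \<bullet>c (P *\<^sub>v v)"
    using assms c by (subst cscalar_prod_mat_adjoint[of _ d]) (auto simp: projector_def)
  finally show "(P *\<^sub>v v) \<bullet>c v = of_real (outcome_prob P v)" using 1 by simp
qed

text \<open>The form \<open>(P *\<^sub>v v) \<bullet>c v\<close> of the probability is linear in the
  projector, so the two outcomes add up to \<open>v \<bullet>c v = 1\<close>.\<close>

lemma outcome_prob_complement:
  assumes "projector d P" "state d v"
  shows "outcome_prob (1\<^sub>m d - P) v = 1 - outcome_prob P v"
proof -
  have c: "P \<in> carrier_mat d d" "v \<in> carrier_vec d"
    using assms by (auto simp: projector_def state_def)
  have "of_real (outcome_prob (1\<^sub>m d - P) v) = ((1\<^sub>m d - P) *\<^sub>v v) \<bullet>c v"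
    using outcome_prob_projector(1)[OF projector_complement] assms c by simp
  also have "\<dots> = v \<bullet>c v - (P *\<^sub>v v) \<bullet>c v"
    using c by (simp add: minus_mult_distrib_mat_vec[of _ d d] minus_scalar_prod_distrib[of _ d])
  also have "\<dots> = of_real (1 - outcome_prob P v)"
    using outcome_prob_projector(1)[OF assms(1) c(2)] assms(2) by (simp add: state_def)
  finally show ?thesis by (simp only: of_real_eq_iff)
qed

text \<open>For a projector \<open>R\<close> this multiplies the range by \<alpha> and fixes the
  kernel; \<alpha> = -1 is the usual reflection.\<close>

definition phase_mat :: "nat \<Rightarrow> complex \<Rightarrow> complex mat \<Rightarrow> complex mat" where
  "phase_mat d \<alpha> R = 1\<^sub>m d - (1 - \<alpha>) \<cdot>\<^sub>m R"

lemma phase_mat_carrier [simp]: "R \<in> carrier_mat d d \<Longrightarrow> phase_mat d \<alpha> R \<in> carrier_mat d d"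
  by (simp add: phase_mat_def minus_carrier_mat)

lemma phase_mat_vec:
  assumes "R \<in> carrier_mat d d" "v \<in> carrier_vec d"
  shows "phase_mat d \<alpha> R *\<^sub>v v = v - (1 - \<alpha>) \<cdot>\<^sub>v (R *\<^sub>v v)"
proof -
  have "((1 - \<alpha>) \<cdot>\<^sub>m R) *\<^sub>v v = (1 - \<alpha>) \<cdot>\<^sub>v (R *\<^sub>v v)"
    using assms by (intro eq_vecI) auto
  then show ?thesis
    using assms unfolding phase_mat_def by (subst minus_mult_distrib_mat_vec[of _ d d]) auto
qed

lemma phase_mat_adjoint:
  assumes "projector d R"
  shows "mat_adjoint (phase_mat d \<alpha> R) = phase_mat d (cnj \<alpha>) R"
proof (rule eq_matI)
  have c: "R \<in> carrier_mat d d" using assms by (rule projector_carrier)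
  fix i j assume "i < dim_row (phase_mat d (cnj \<alpha>) R)" "j < dim_col (phase_mat d (cnj \<alpha>) R)"
  then have ij: "i < d" "j < d" using c by (auto simp: phase_mat_def)
  then have "cnj (R $$ (j, i)) = R $$ (i, j)"
    using assms c mat_adjoint_index[of i R j] by (simp add: projector_def)
  then show "mat_adjoint (phase_mat d \<alpha> R) $$ (i, j) = phase_mat d (cnj \<alpha>) R $$ (i, j)"
    using ij c by (auto simp: phase_mat_def)
qed (use projector_carrier[OF assms] in \<open>auto simp: phase_mat_def\<close>)

lemma phase_mat_mult_inverse:
  assumes "projector d R" "\<alpha> * \<beta> = 1"
  shows "phase_mat d \<alpha> R * phase_mat d \<beta> R = 1\<^sub>m d"
proof (rule eq_matI)
  have c: "R \<in> carrier_mat d d" and RR: "R * R = R" using assms by (auto simp: projector_def)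
  fix i j assume "i < dim_row (1\<^sub>m d :: complex mat)" "j < dim_col (1\<^sub>m d :: complex mat)"
  then have ij: "i < d" "j < d" by auto
  have "phase_mat d \<alpha> R * phase_mat d \<beta> R =
      1\<^sub>m d - (1 - \<alpha>) \<cdot>\<^sub>m R - ((1 - \<beta>) \<cdot>\<^sub>m R - (1 - \<alpha>) \<cdot>\<^sub>m ((1 - \<beta>) \<cdot>\<^sub>m R))"
    using c unfolding phase_mat_def
    using c by (subst mult_minus_distrib_mat[of _ d d _ d])
      (auto simp: minus_mult_distrib_mat[of _ d d _ _ d] RR mult_smult_assoc_mat[of _ d d _ d]
        mult_smult_distrib[of _ d d _ d] right_mult_one_mat[of _ d d] left_mult_one_mat[of _ d d])
  \<comment> \<open>Because \<open>R * R = R\<close>, the product of two phases is again of the form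
    \<open>phase_mat\<close>, with the phase \<open>\<alpha> * \<beta>\<close>.\<close>
  moreover have "(1 - \<alpha>) * R $$ (i, j) + ((1 - \<beta>) * R $$ (i, j) - (1 - \<alpha>) * ((1 - \<beta>) * R $$ (i, j)))
      = (1 - \<alpha> * \<beta>) * R $$ (i, j)"
    by (simp add: algebra_simps)
  ultimately show "(phase_mat d \<alpha> R * phase_mat d \<beta> R) $$ (i, j) = 1\<^sub>m d $$ (i, j)"
    using ij c assms(2) by (auto simp: algebra_simps)
qed (use projector_carrier[OF assms(1)] in \<open>auto simp: phase_mat_def\<close>)

lemma unitary_phase_mat:
  assumes "projector d R" "cmod \<alpha> = 1"
  shows "unitary_mat d (phase_mat d \<alpha> R)"
proof -
  have "\<alpha> * cnj \<alpha> = 1" using complex_norm_square[of \<alpha>] assms(2) by simp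
  then show ?thesis
    using assms projector_carrier[OF assms(1)]
    by (simp add: unitary_mat_def phase_mat_adjoint phase_mat_mult_inverse mult.commute)
qed

text \<open>A sum of rank-one operators, one for each \<open>z y\<close>; for an orthonormal family
  it is the orthogonal projector onto the span.\<close>

definition span_projector :: "nat \<Rightarrow> 'i set \<Rightarrow> ('i \<Rightarrow> complex vec) \<Rightarrow> complex mat" where
  "span_projector d I z = mat d d (\<lambda>(i, j). \<Sum>y\<in>I. z y $ i * cnj (z y $ j))"

lemma span_projector_carrier [simp]: "span_projector d I z \<in> carrier_mat d d"
  by (simp add: span_projector_def)

lemma span_projector_vec:
  assumes "\<And>y. y \<in> I \<Longrightarrow> z y \<in> carrier_vec d" "u \<in> carrier_vec d" "i < d"
  shows "(span_projector d I z *\<^sub>v u) $ i = (\<Sum>y\<in>I. (u \<bullet>c z y) * z y $ i)"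
proof -
  have "(span_projector d I z *\<^sub>v u) $ i = (\<Sum>j<d. (\<Sum>y\<in>I. z y $ i * cnj (z y $ j)) * u $ j)"
    using assms by (subst mult_mat_vec_sum[where d = d]) (auto simp: span_projector_def)
  also have "\<dots> = (\<Sum>y\<in>I. \<Sum>j<d. z y $ i * cnj (z y $ j) * u $ j)"
    unfolding sum_distrib_right by (rule sum.swap)
  also have "\<dots> = (\<Sum>y\<in>I. (u \<bullet>c z y) * z y $ i)"
    using assms by (intro sum.cong refl, subst cscalar_prod_sum[where d = d])
      (auto simp: sum_distrib_right sum_distrib_left mult_ac)
  finally show ?thesis .
qed

lemma span_projector_single_overlap:
  assumes "finite I" "\<And>y. y \<in> I \<Longrightarrow> z y \<in> carrier_vec d" "u \<in> carrier_vec d"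
    and "y \<in> I" "\<And>y'. y' \<in> I \<Longrightarrow> y' \<noteq> y \<Longrightarrow> u \<bullet>c z y' = 0"
  shows "span_projector d I z *\<^sub>v u = (u \<bullet>c z y) \<cdot>\<^sub>v z y"
proof (rule eq_vecI)
  fix i assume "i < dim_vec ((u \<bullet>c z y) \<cdot>\<^sub>v z y)"
  then have i: "i < d" using assms(2)[OF assms(4)] by simp
  have "(\<Sum>y'\<in>I. (u \<bullet>c z y') * z y' $ i) = (\<Sum>y'\<in>I. if y' = y then (u \<bullet>c z y) * z y $ i else 0)"
    using assms by (intro sum.cong) auto
  then have "(span_projector d I z *\<^sub>v u) $ i = (u \<bullet>c z y) * z y $ i"
    using assms i span_projector_vec[of I z d u i] by simp
  moreover have "i < dim_vec (z y)" using i assms(2)[OF assms(4)] by simp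
  ultimately show "(span_projector d I z *\<^sub>v u) $ i = ((u \<bullet>c z y) \<cdot>\<^sub>v z y) $ i" by simp
qed (use assms(2)[OF assms(4)] in \<open>simp add: span_projector_def\<close>)

lemma projector_span_projector:
  assumes I: "finite I" and c: "\<And>y. y \<in> I \<Longrightarrow> z y \<in> carrier_vec d"
    and orth: "\<And>y y'. y \<in> I \<Longrightarrow> y' \<in> I \<Longrightarrow> z y \<bullet>c z y' = of_bool (y = y')"
  shows "projector d (span_projector d I z)"
proof -
  let ?P = "span_projector d I z"
  have "?P * ?P = ?P"
  proof (rule eq_matI)
    fix i j assume "i < dim_row ?P" "j < dim_col ?P"
    then have ij: "i < d" "j < d" by (auto simp: span_projector_def)
    \<comment> \<open>The product is computed column by column, so that
      \<open>span_projector_vec\<close> applies.\<close>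
    have "(?P * ?P) $$ (i, j) = (?P *\<^sub>v col ?P j) $ i"
      using ij by (simp add: span_projector_def)
    also have "\<dots> = (\<Sum>y\<in>I. (col ?P j \<bullet>c z y) * z y $ i)"
      using c ij by (intro span_projector_vec) (auto simp: span_projector_def)
    also have "\<dots> = (\<Sum>y\<in>I. cnj (z y $ j) * z y $ i)"
    proof (intro sum.cong refl arg_cong2[where f = "(*)"])
      fix y assume y: "y \<in> I"
      have "col ?P j \<bullet>c z y = (\<Sum>k<d. \<Sum>y'\<in>I. z y' $ k * cnj (z y' $ j) * cnj (z y $ k))"
        using c[OF y] ij by (subst cscalar_prod_sum[where d = d]) (auto simp: span_projector_def sum_distrib_right)
      also have "\<dots> = (\<Sum>y'\<in>I. \<Sum>k<d. z y' $ k * cnj (z y' $ j) * cnj (z y $ k))"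
        by (rule sum.swap)
      also have "\<dots> = (\<Sum>y'\<in>I. (z y' \<bullet>c z y) * cnj (z y' $ j))"
        using c y by (intro sum.cong refl, subst cscalar_prod_sum[where d = d]) (auto simp: sum_distrib_right sum_distrib_left mult_ac)
      also have "\<dots> = (\<Sum>y'\<in>I. if y' = y then cnj (z y $ j) else 0)"
        using orth y by (intro sum.cong) auto
      also have "\<dots> = cnj (z y $ j)" using I y by simp
      finally show "col ?P j \<bullet>c z y = cnj (z y $ j)" .
    qed
    also have "\<dots> = ?P $$ (i, j)" using ij by (simp add: span_projector_def mult.commute)
    finally show "(?P * ?P) $$ (i, j) = ?P $$ (i, j)" .
  qed (auto simp: span_projector_def)
  moreover have "mat_adjoint ?P = ?P"
    by (rule eq_matI) (auto simp: span_projector_def mult.commute)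
  ultimately show ?thesis by (simp add: projector_def)
qed

subsection \<open>Tensor products and circuits\<close>

lemma kron_vec_carrier [simp]:
  "u \<in> carrier_vec d \<Longrightarrow> v \<in> carrier_vec e \<Longrightarrow> kron_vec u v \<in> carrier_vec (d * e)"
  by (auto simp: kron_vec_def)

lemma kron_mat_carrier [simp]:
  "A \<in> carrier_mat r c \<Longrightarrow> B \<in> carrier_mat r' c' \<Longrightarrow> kron_mat A B \<in> carrier_mat (r * r') (c * c')"
  by (auto simp: kron_mat_def)

lemma div_mod_less:
  assumes "i < d * (e :: nat)"
  shows "i div e < d" "i mod e < e"
proof -
  have "e > 0" using assms by (cases "e = 0") auto
  then show "i div e < d" "i mod e < e" using assms by (auto simp: less_mult_imp_div_less)
qed

lemma kron_mat_vec:
  assumes "A \<in> carrier_mat d d" "B \<in> carrier_mat e e" "u \<in> carrier_vec d" "v \<in> carrier_vec e"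
  shows "kron_mat A B *\<^sub>v kron_vec u v = kron_vec (A *\<^sub>v u) (B *\<^sub>v v)"
proof (rule eq_vecI)
  fix i assume "i < dim_vec (kron_vec (A *\<^sub>v u) (B *\<^sub>v v))"
  then have i: "i < d * e" using assms by (auto simp: kron_vec_def)
  note im = div_mod_less[OF i]
  have "(kron_mat A B *\<^sub>v kron_vec u v) $ i =
      (\<Sum>j<d * e. A $$ (i div e, j div e) * B $$ (i mod e, j mod e) * (u $ (j div e) * v $ (j mod e)))"
    using assms i by (subst mult_mat_vec_sum[where d = "d * e"]) (auto simp: kron_mat_def kron_vec_def)
  also have "\<dots> = (\<Sum>a<d. \<Sum>b<e. A $$ (i div e, a) * B $$ (i mod e, b) * (u $ a * v $ b))"
    by (rule sum_lessThan_div_mod)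
  also have "\<dots> = (\<Sum>a<d. A $$ (i div e, a) * u $ a) * (\<Sum>b<e. B $$ (i mod e, b) * v $ b)"
    by (simp add: sum_product mult_ac)
  also have "\<dots> = (A *\<^sub>v u) $ (i div e) * (B *\<^sub>v v) $ (i mod e)"
    using assms im mult_mat_vec_sum[of u d "i div e" A] mult_mat_vec_sum[of v e "i mod e" B] by simp
  also have "\<dots> = kron_vec (A *\<^sub>v u) (B *\<^sub>v v) $ i"
    using assms i by (simp add: kron_vec_def)
  finally show "(kron_mat A B *\<^sub>v kron_vec u v) $ i = kron_vec (A *\<^sub>v u) (B *\<^sub>v v) $ i" .
qed (use assms in \<open>auto simp: kron_mat_def kron_vec_def\<close>)

lemma kron_vec_cscalar_prod:
  assumes "u \<in> carrier_vec d" "u' \<in> carrier_vec d" "v \<in> carrier_vec e" "v' \<in> carrier_vec e"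
  shows "kron_vec u v \<bullet>c kron_vec u' v' = (u \<bullet>c u') * (v \<bullet>c v')"
proof -
  have "kron_vec u v \<bullet>c kron_vec u' v' =
      (\<Sum>i<d * e. u $ (i div e) * v $ (i mod e) * cnj (u' $ (i div e) * v' $ (i mod e)))"
    using assms by (subst cscalar_prod_sum[where d = "d * e"]) (auto simp: kron_vec_def)
  also have "\<dots> = (\<Sum>a<d. \<Sum>b<e. u $ a * v $ b * cnj (u' $ a * v' $ b))"
    by (rule sum_lessThan_div_mod)
  also have "\<dots> = (\<Sum>a<d. u $ a * cnj (u' $ a)) * (\<Sum>b<e. v $ b * cnj (v' $ b))"
    by (simp add: sum_product mult_ac)
  also have "\<dots> = (u \<bullet>c u') * (v \<bullet>c v')"
    using assms cscalar_prod_sum[of u' d u] cscalar_prod_sum[of v' e v] by simp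
  finally show ?thesis .
qed

lemma kron_vec_state: "state d u \<Longrightarrow> state e v \<Longrightarrow> state (d * e) (kron_vec u v)"
  by (auto simp: state_def kron_vec_cscalar_prod)

text \<open>Linearity in the left factor, in the shape that \<open>phase_mat_vec\<close>
  produces.\<close>

lemma kron_vec_minus_smult:
  assumes "u \<in> carrier_vec d" "w \<in> carrier_vec d"
  shows "kron_vec (u - c \<cdot>\<^sub>v w) v = kron_vec u v - c \<cdot>\<^sub>v kron_vec w v"
proof (rule eq_vecI)
  fix i assume "i < dim_vec (kron_vec u v - c \<cdot>\<^sub>v kron_vec w v)"
  then have i: "i < d * dim_vec v" using assms by (auto simp: kron_vec_def)
  then show "kron_vec (u - c \<cdot>\<^sub>v w) v $ i = (kron_vec u v - c \<cdot>\<^sub>v kron_vec w v) $ i"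
    using assms div_mod_less[OF i] by (simp add: kron_vec_def algebra_simps)
qed (use assms in \<open>auto simp: kron_vec_def\<close>)

lemma kron_mat_mult:
  assumes "A \<in> carrier_mat d d" "B \<in> carrier_mat e e" "A' \<in> carrier_mat d d" "B' \<in> carrier_mat e e"
  shows "kron_mat A B * kron_mat A' B' = kron_mat (A * A') (B * B')"
proof (rule eq_matI)
  fix i j assume "i < dim_row (kron_mat (A * A') (B * B'))" "j < dim_col (kron_mat (A * A') (B * B'))"
  then have ij: "i < d * e" "j < d * e" using assms by (auto simp: kron_mat_def)
  note im = div_mod_less[OF ij(1)] and jm = div_mod_less[OF ij(2)]
  have "(kron_mat A B * kron_mat A' B') $$ (i, j) =
      (\<Sum>k<d * e. A $$ (i div e, k div e) * B $$ (i mod e, k mod e) * (A' $$ (k div e, j div e) * B' $$ (k mod e, j mod e)))"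
    using assms ij by (subst mult_mat_sum[where d = "d * e"]) (auto simp: kron_mat_def)
  also have "\<dots> = (\<Sum>a<d. \<Sum>b<e. A $$ (i div e, a) * B $$ (i mod e, b) * (A' $$ (a, j div e) * B' $$ (b, j mod e)))"
    by (rule sum_lessThan_div_mod)
  also have "\<dots> = (\<Sum>a<d. A $$ (i div e, a) * A' $$ (a, j div e)) * (\<Sum>b<e. B $$ (i mod e, b) * B' $$ (b, j mod e))"
    by (simp add: sum_product mult_ac)
  also have "\<dots> = (A * A') $$ (i div e, j div e) * (B * B') $$ (i mod e, j mod e)"
    using assms im jm mult_mat_sum[of "i div e" A "j div e" A' d] mult_mat_sum[of "i mod e" B "j mod e" B' e] by simp
  also have "\<dots> = kron_mat (A * A') (B * B') $$ (i, j)"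
    using assms ij by (simp add: kron_mat_def)
  finally show "(kron_mat A B * kron_mat A' B') $$ (i, j) = kron_mat (A * A') (B * B') $$ (i, j)" .
qed (use assms in \<open>auto simp: kron_mat_def\<close>)

lemma kron_mat_adjoint:
  assumes "A \<in> carrier_mat d d" "B \<in> carrier_mat e e"
  shows "mat_adjoint (kron_mat A B) = kron_mat (mat_adjoint A) (mat_adjoint B)"
proof (rule eq_matI)
  fix i j assume "i < dim_row (kron_mat (mat_adjoint A) (mat_adjoint B))"
    "j < dim_col (kron_mat (mat_adjoint A) (mat_adjoint B))"
  then have ij: "i < d * e" "j < d * e" using assms by (auto simp: kron_mat_def)
  then show "mat_adjoint (kron_mat A B) $$ (i, j) = kron_mat (mat_adjoint A) (mat_adjoint B) $$ (i, j)"
    using assms div_mod_less[OF ij(1)] div_mod_less[OF ij(2)] by (simp add: kron_mat_def)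
qed (use assms in \<open>auto simp: kron_mat_def\<close>)

lemma kron_mat_one: "kron_mat (1\<^sub>m d) (1\<^sub>m e) = 1\<^sub>m (d * e)"
proof (rule eq_matI)
  fix i j assume "i < dim_row (1\<^sub>m (d * e) :: complex mat)" "j < dim_col (1\<^sub>m (d * e) :: complex mat)"
  then have ij: "i < d * e" "j < d * e" by auto
  have "i = j" if "i div e = j div e" "i mod e = j mod e" using that by (metis div_mult_mod_eq)
  then show "kron_mat (1\<^sub>m d) (1\<^sub>m e) $$ (i, j) = 1\<^sub>m (d * e) $$ (i, j)"
    using ij div_mod_less[OF ij(1)] div_mod_less[OF ij(2)] by (auto simp: kron_mat_def)
qed (auto simp: kron_mat_def)

lemma unitary_kron_mat:
  assumes "unitary_mat d A" "unitary_mat e B"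
  shows "unitary_mat (d * e) (kron_mat A B)"
  using assms by (auto simp: unitary_mat_def kron_mat_mult[of _ d _ e] kron_mat_adjoint[of _ d _ e] kron_mat_one)

lemma projector_kron_mat:
  assumes "projector d A" "projector e B"
  shows "projector (d * e) (kron_mat A B)"
  using assms by (auto simp: projector_def kron_mat_mult[of _ d _ e] kron_mat_adjoint[of _ d _ e])

lemma outcome_prob_kron_one:
  assumes "P \<in> carrier_mat d d" "u \<in> carrier_vec d" "state e v"
  shows "outcome_prob (kron_mat P (1\<^sub>m e)) (kron_vec u v) = outcome_prob P u"
  using assms by (simp add: outcome_prob_def state_def kron_mat_vec[of _ d _ e] kron_vec_cscalar_prod[of _ d _ _ e])

section \<open>Composition of gates, unitarity of circuits, and their initial states\<close>

lemma compose_mats_carrier: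
  "\<forall>A\<in>set As. A \<in> carrier_mat d d \<Longrightarrow> compose_mats d As \<in> carrier_mat d d"
  by (induction As) auto

text \<open>The head of the list acts first. The induction therefore absorbs it into the vector,
  which has to stay arbitrary.\<close>

lemma compose_mats_append_vec:
  assumes "\<forall>A\<in>set As. A \<in> carrier_mat d d" "\<forall>B\<in>set Bs. B \<in> carrier_mat d d" "v \<in> carrier_vec d"
  shows "compose_mats d (As @ Bs) *\<^sub>v v = compose_mats d Bs *\<^sub>v (compose_mats d As *\<^sub>v v)"
  using assms
proof (induction As arbitrary: v)
  case (Cons A As)
  have "compose_mats d ((A # As) @ Bs) *\<^sub>v v = compose_mats d (As @ Bs) *\<^sub>v (A *\<^sub>v v)"
    using Cons.prems compose_mats_carrier[of "As @ Bs" d] by (auto intro!: assoc_mult_mat_vec[of _ d d _ d])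
  also have "\<dots> = compose_mats d Bs *\<^sub>v (compose_mats d As *\<^sub>v (A *\<^sub>v v))"
    using Cons by auto
  also have "compose_mats d As *\<^sub>v (A *\<^sub>v v) = compose_mats d (A # As) *\<^sub>v v"
    using Cons.prems compose_mats_carrier[of As d] by (auto intro!: assoc_mult_mat_vec[of _ d d _ d, symmetric])
  finally show ?case .
qed simp

lemma unitary_compose_mats: "\<forall>A\<in>set As. unitary_mat d A \<Longrightarrow> unitary_mat d (compose_mats d As)"
  by (induction As) (auto intro: unitary_mat_one unitary_mat_mult)

lemma unitary_oracle_mat: "unitary_mat (2 ^ (q + 1)) (oracle_mat q g)"
proof -
  \<comment> \<open>The query permutes the basis: it keeps the argument \<open>j div 2\<close> and
    flips the last bit iff \<open>g\<close> holds there. Flipping twice is the identity.\<close>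
  define \<sigma> where "\<sigma> j = 2 * (j div 2) + (j mod 2 + of_bool (g (j div 2))) mod 2" for j :: nat
  have div: "\<sigma> j div 2 = j div 2" for j by (simp add: \<sigma>_def)
  have mod: "\<sigma> j mod 2 = (j mod 2 + of_bool (g (j div 2))) mod 2" for j by (simp add: \<sigma>_def)
  have inv: "\<sigma> (\<sigma> j) = j" for j
  proof -
    have "\<sigma> (\<sigma> j) = 2 * (j div 2) + ((j mod 2 + of_bool (g (j div 2))) mod 2 + of_bool (g (j div 2))) mod 2"
      unfolding \<sigma>_def[of "\<sigma> j"] div mod ..
    then show ?thesis by (cases "g (j div 2)") presburger+
  qed
  have "\<sigma> j < 2 ^ (q + 1)" if "j < 2 ^ (q + 1)" for j
  proof -
    have "j div 2 < 2 ^ q" using that by auto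
    then have "\<sigma> j div 2 < 2 ^ q" by (simp add: div)
    then show ?thesis by auto
  qed
  moreover have "oracle_mat q g = mat (2 ^ (q + 1)) (2 ^ (q + 1)) (\<lambda>(i, j). of_bool (i = \<sigma> j))"
  proof -
    have "i = \<sigma> j \<longleftrightarrow> i div 2 = j div 2 \<and> i mod 2 = (j mod 2 + of_bool (g (j div 2))) mod 2" for i j
      using div mod by (metis div_mult_mod_eq)
    then show ?thesis by (intro eq_matI) (auto simp: oracle_mat_def)
  qed
  ultimately show ?thesis using unitary_mat_involution[of "2 ^ (q + 1)" \<sigma>] inv by simp
qed

lemma unitary_circuit_mat:
  assumes "valid_input n X s \<phi>" "\<forall>g\<in>set C. valid_gate n s g"
  shows "unitary_mat (2 ^ n) (circuit_mat n s C x)"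
  unfolding circuit_mat_def
proof (rule unitary_compose_mats, clarsimp)
  fix g assume "g \<in> set C"
  then have g: "valid_gate n s g" using assms(2) by auto
  show "unitary_mat (2 ^ n) (gate_mat n s x g)"
  proof (cases g)
    case Query
    then obtain q f where s: "s = Oracle q f" using g by (cases s) auto
    \<comment> \<open>\<open>valid_input\<close> gives \<open>q + 1 \<le> n\<close>, so the
      truncated difference is the true number of idle qubits.\<close>
    then have "(2 :: nat) ^ (q + 1) * 2 ^ (n - (q + 1)) = 2 ^ n"
      using assms(1) by (subst power_add[symmetric]) simp
    then show ?thesis
      using unitary_kron_mat[OF unitary_oracle_mat[of q "f x"] unitary_mat_one[of "2 ^ (n - (q + 1))"]] Query s
      by (simp del: power_Suc)
  qed (use g in auto)
qed

lemma unit_vec_cscalar_prod: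
  assumes "i < d" "j < d"
  shows "unit_vec d i \<bullet>c (unit_vec d j :: complex vec) = of_bool (i = j)"
proof -
  have "unit_vec d i \<bullet>c (unit_vec d j :: complex vec) = (\<Sum>k<d. unit_vec d i $ k * cnj (unit_vec d j $ k))"
    by (rule cscalar_prod_sum) simp
  also have "\<dots> = (\<Sum>k<d. if k = i then of_bool (k = j) else 0)"
    by (rule sum.cong) (use assms in auto)
  finally show ?thesis using assms by simp
qed

lemma state_unit_vec: "i < d \<Longrightarrow> state d (unit_vec d i)"
  by (simp add: state_def unit_vec_cscalar_prod)

lemma state_initial_state:
  assumes "valid_input n X s \<phi>" "x \<in> X"
  shows "state (2 ^ n) (initial_state s \<phi> x)"
proof (cases s)
  case (Encoded m enc)
  then have "enc x < 2 ^ m" and \<phi>: "state (2 ^ (n - m)) \<phi>" and m: "m \<le> n" using assms by auto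
  then have "state (2 ^ m * 2 ^ (n - m)) (kron_vec (unit_vec (2 ^ m) (enc x)) \<phi>)"
    by (intro kron_vec_state state_unit_vec)
  then show ?thesis using Encoded m by (simp add: power_add[symmetric])
qed (use assms in auto)

subsection \<open>One amplification step\<close>

abbreviation ray_projector :: "nat \<Rightarrow> complex vec \<Rightarrow> complex mat" where
  "ray_projector d s \<equiv> span_projector d {()} (\<lambda>_. s)"

lemma projector_ray_projector: "state d s \<Longrightarrow> projector d (ray_projector d s)"
  by (rule projector_span_projector) (auto simp: state_def)

lemma ray_projector_vec:
  "state d s \<Longrightarrow> u \<in> carrier_vec d \<Longrightarrow> ray_projector d s *\<^sub>v u = (u \<bullet>c s) \<cdot>\<^sub>v s"
  by (rule span_projector_single_overlap) (auto simp: state_def)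

text \<open>One round of amplitude amplification with free phases in place of the two sign changes.
  From right to left: prepare, mark the range of \<open>R\<close>, undo the preparation, put a phase
  on the initial state, prepare again.\<close>

definition amplify :: "nat \<Rightarrow> complex mat \<Rightarrow> complex vec \<Rightarrow> complex \<Rightarrow> complex \<Rightarrow> complex mat \<Rightarrow> complex mat" where
  "amplify d R s \<alpha> \<beta> W =
     W * (phase_mat d \<beta> (ray_projector d s) * (mat_adjoint W * (phase_mat d \<alpha> R * W)))"

text \<open>Conjugated by \<open>W\<close>, the phase on the ray of \<open>s\<close> is a phase on
  the ray of \<open>w = W s\<close>. Hence everything takes place in the span of \<open>w\<close>
  and \<open>g = R w\<close>, and since \<open>R\<close> sends both to \<open>g\<close>, the new
  marked component is a multiple of the old one.\<close>

lemma outcome_prob_amplify: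
  assumes R: "projector d R" and W: "unitary_mat d W" and s: "state d s"
  defines "p \<equiv> outcome_prob R (W *\<^sub>v s)"
  shows "outcome_prob R (amplify d R s \<alpha> \<beta> W *\<^sub>v s)
    = (cmod (\<alpha> - (1 - \<beta>) * (1 - (1 - \<alpha>) * of_real p)))\<^sup>2 * p"
proof -
  define w g v where "w = W *\<^sub>v s" and "g = R *\<^sub>v w" and "v = phase_mat d \<alpha> R *\<^sub>v w"
  define t where "t = 1 - (1 - \<alpha>) * of_real p"
  have c: "R \<in> carrier_mat d d" "W \<in> carrier_mat d d" "mat_adjoint W \<in> carrier_mat d d"
    "s \<in> carrier_vec d" "phase_mat d \<alpha> R \<in> carrier_mat d d"
    "phase_mat d \<beta> (ray_projector d s) \<in> carrier_mat d d"
    using R W s by (auto simp: projector_def unitary_mat_def state_def)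
  have ws: "state d w" unfolding w_def using W s by (rule unitary_mat_state)
  have cw: "w \<in> carrier_vec d" "g \<in> carrier_vec d" "v \<in> carrier_vec d"
    unfolding w_def g_def v_def using c by (blast intro: mult_mat_vec_carrier)+
  have v: "v = w - (1 - \<alpha>) \<cdot>\<^sub>v g" using c cw by (simp add: v_def g_def phase_mat_vec)
  have gw: "g \<bullet>c w = of_real p" "g \<bullet>c g = of_real p"
    using outcome_prob_projector(1,2)[OF R cw(1)] by (simp_all add: g_def w_def p_def)
  have "v \<bullet>c w = w \<bullet>c w - (1 - \<alpha>) * (g \<bullet>c w)"
    using cw by (simp add: v minus_scalar_prod_distrib[of _ d])
  then have vw: "v \<bullet>c w = t" using ws gw by (simp add: state_def t_def)
  have WW: "W *\<^sub>v (mat_adjoint W *\<^sub>v v) = v"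
    using W c cw assoc_mult_mat_vec[of W d d "mat_adjoint W" d v] by (simp add: unitary_mat_def)
  \<comment> \<open>The overlap with \<open>s\<close> after undoing \<open>W\<close> is the overlap
    \<open>t\<close> of \<open>v\<close> with \<open>w\<close>; it is the weight on which the second
    phase acts.\<close>
  have "(mat_adjoint W *\<^sub>v v) \<bullet>c s = t"
    using cscalar_prod_mat_adjoint[OF c(3) cw(3) c(4)] vw by (simp add: w_def)
  then have "phase_mat d \<beta> (ray_projector d s) *\<^sub>v (mat_adjoint W *\<^sub>v v)
      = mat_adjoint W *\<^sub>v v - ((1 - \<beta>) * t) \<cdot>\<^sub>v s"
    using s mult_mat_vec_carrier[OF c(3) cw(3)] by (simp add: phase_mat_vec ray_projector_vec smult_smult_assoc)
  then have "W *\<^sub>v (phase_mat d \<beta> (ray_projector d s) *\<^sub>v (mat_adjoint W *\<^sub>v v))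
      = v - ((1 - \<beta>) * t) \<cdot>\<^sub>v w"
    using c(2,4) WW mult_mat_vec_carrier[OF c(3) cw(3)]
    by (simp add: mult_minus_distrib_mat_vec[of _ d d] mult_mat_vec[of _ d d] w_def)
  moreover have "amplify d R s \<alpha> \<beta> W *\<^sub>v s =
      W *\<^sub>v (phase_mat d \<beta> (ray_projector d s) *\<^sub>v (mat_adjoint W *\<^sub>v v))"
    using c by (simp add: amplify_def v_def w_def assoc_mult_mat_vec[of _ d d _ d] mult_carrier_mat[of _ d d _ d])
  ultimately have out: "amplify d R s \<alpha> \<beta> W *\<^sub>v s = v - ((1 - \<beta>) * t) \<cdot>\<^sub>v w" by simp
  have Rg: "R *\<^sub>v g = g" unfolding g_def by (rule projector_apply_twice[OF R cw(1)])
  have "R *\<^sub>v (v - ((1 - \<beta>) * t) \<cdot>\<^sub>v w) = g - (1 - \<alpha>) \<cdot>\<^sub>v g - ((1 - \<beta>) * t) \<cdot>\<^sub>v g"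
    using c cw by (simp add: v mult_minus_distrib_mat_vec[of _ d d] mult_mat_vec[of _ d d] Rg g_def[symmetric])
  also have "\<dots> = (\<alpha> - (1 - \<beta>) * t) \<cdot>\<^sub>v g"
    using cw by (intro eq_vecI) (auto simp: algebra_simps)
  finally have "outcome_prob R (amplify d R s \<alpha> \<beta> W *\<^sub>v s)
      = Re (((\<alpha> - (1 - \<beta>) * t) \<cdot>\<^sub>v g) \<bullet>c ((\<alpha> - (1 - \<beta>) * t) \<cdot>\<^sub>v g))"
    by (simp add: outcome_prob_def out)
  also have "\<dots> = Re ((\<alpha> - (1 - \<beta>) * t) * cnj (\<alpha> - (1 - \<beta>) * t) * of_real p)"
    using cw gw by (simp add: conjugate_smult_vec mult_ac)
  also have "\<dots> = (cmod (\<alpha> - (1 - \<beta>) * t))\<^sup>2 * p"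
    by (simp only: complex_norm_square[symmetric] of_real_mult[symmetric] Re_complex_of_real)
  finally show ?thesis by (simp add: t_def)
qed

section \<open>Choice of the phases\<close>

lemma unit_complex_with_Re:
  assumes "\<bar>c\<bar> \<le> 1"
  obtains \<alpha> where "cmod \<alpha> = 1" "Re \<alpha> = c"
proof -
  have "c\<^sup>2 \<le> 1" using assms by (simp add: abs_square_le_1)
  then show ?thesis
    by (intro that[of "Complex c (sqrt (1 - c\<^sup>2))"]) (auto simp: cmod_def)
qed

text \<open>The points with real part 1/2 are equidistant from 0 and 1, so
  \<open>(t - 1) / t\<close> lies on the unit circle and can serve as \<beta>.\<close>

lemma phase_solving_half_plane:
  assumes "Re t = 1 / 2"
  obtains \<beta> where "cmod \<beta> = 1" "(1 - \<beta>) * t = 1"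
proof -
  have t: "t \<noteq> 0" using assms by auto
  have "cmod (t - 1) = cmod t" using assms by (simp add: cmod_def power2_eq_square field_simps)
  then have "cmod ((t - 1) / t) = 1" using t by (simp add: norm_divide)
  then show ?thesis using t by (intro that[of "(t - 1) / t"]) (auto simp: field_simps)
qed

text \<open>For unimodular \<alpha> the coefficient at \<open>p\<close> equals
  \<open>\<alpha> * (1 - (1 - \<beta>) * t)\<close> with
  \<open>t = p + (1 - p) * cnj \<alpha>\<close>. It can be made to vanish once
  \<open>Re t = 1 / 2\<close>, which prescribes \<open>Re \<alpha>\<close>; the prescribed value is
  at least -1 precisely as long as \<open>p \<le> 3 / 4\<close>.\<close>

lemma annihilating_phases:
  fixes p :: real
  assumes "0 \<le> p" "p \<le> 3 / 4"
  obtains \<alpha> \<beta> where "cmod \<alpha> = 1" "cmod \<beta> = 1"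
    "\<And>q. \<alpha> - (1 - \<beta>) * (1 - (1 - \<alpha>) * of_real q) = 0 \<longleftrightarrow> q = p"
proof -
  have "\<bar>(1 / 2 - p) / (1 - p)\<bar> \<le> 1" using assms by (auto simp: abs_le_iff field_simps)
  then obtain \<alpha> where \<alpha>: "cmod \<alpha> = 1" "Re \<alpha> = (1 / 2 - p) / (1 - p)" by (rule unit_complex_with_Re)
  define t where "t = of_real p + of_real (1 - p) * cnj \<alpha>"
  have Re_t: "Re t = 1 / 2" using assms \<alpha> by (simp add: t_def)
  then obtain \<beta> where \<beta>: "cmod \<beta> = 1" "(1 - \<beta>) * t = 1" by (rule phase_solving_half_plane)
  have \<alpha>\<alpha>: "\<alpha> * cnj \<alpha> = 1" using complex_norm_square[of \<alpha>] \<alpha> by simp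
  \<comment> \<open>With \<beta> = 1 the equation for \<open>t\<close> would read 0 = 1, and with
    \<alpha> = 1 one would have \<open>t = 1\<close>, against \<open>Re t = 1 / 2\<close>.\<close>
  have ne: "\<beta> \<noteq> 1" "\<alpha> \<noteq> 1" using \<beta>(2) Re_t by (auto simp: t_def)
  have "1 - (1 - \<alpha>) * of_real p = \<alpha> * t"
    using \<alpha>\<alpha> by (simp add: t_def algebra_simps)
  then have "\<alpha> - (1 - \<beta>) * (1 - (1 - \<alpha>) * of_real p) = \<alpha> * (1 - (1 - \<beta>) * t)"
    by (simp add: algebra_simps)
  then have zero: "\<alpha> - (1 - \<beta>) * (1 - (1 - \<alpha>) * of_real p) = 0" using \<beta>(2) by simp
  \<comment> \<open>The coefficient is affine in \<open>q\<close> with nonzero slope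
    \<open>(1 - \<beta>) * (1 - \<alpha>)\<close>, so \<open>p\<close> is its only zero.\<close>
  have "\<alpha> - (1 - \<beta>) * (1 - (1 - \<alpha>) * of_real q)
      = \<alpha> - (1 - \<beta>) * (1 - (1 - \<alpha>) * of_real p) + (1 - \<beta>) * (1 - \<alpha>) * of_real (q - p)" for q
    by (simp add: algebra_simps)
  then have "\<alpha> - (1 - \<beta>) * (1 - (1 - \<alpha>) * of_real q) = (1 - \<beta>) * (1 - \<alpha>) * of_real (q - p)" for q
    unfolding zero by simp
  then have "\<alpha> - (1 - \<beta>) * (1 - (1 - \<alpha>) * of_real q) = 0 \<longleftrightarrow> q = p" for q
    using ne by simp
  with \<alpha>(1) \<beta>(1) show ?thesis by (rule that)
qed

text \<open>If \<open>(1 - \<beta>) * t = 1\<close> for \<open>t = 1 - (1 - \<alpha>) * p\<close>,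
  the coefficient is \<open>\<alpha> - 1\<close>, whose squared modulus is
  \<open>2 - 2 * Re \<alpha>\<close>. The choice of \<open>Re \<alpha>\<close> makes this
  \<open>1 / p\<close> and at the same time gives \<open>Re t = 1 / 2\<close>; it is at least -1
  because \<open>p \<ge> 1 / 4\<close>.\<close>

lemma saturating_phases:
  fixes p :: real
  assumes "1 / 4 \<le> p"
  obtains \<alpha> \<beta> where "cmod \<alpha> = 1" "cmod \<beta> = 1"
    "(cmod (\<alpha> - (1 - \<beta>) * (1 - (1 - \<alpha>) * of_real p)))\<^sup>2 * p = 1"
proof -
  have "\<bar>1 - 1 / (2 * p)\<bar> \<le> 1" using assms by (auto simp: abs_le_iff field_simps)
  then obtain \<alpha> where \<alpha>: "cmod \<alpha> = 1" "Re \<alpha> = 1 - 1 / (2 * p)" by (rule unit_complex_with_Re)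
  have "Re (1 - (1 - \<alpha>) * of_real p) = 1 / 2" using assms \<alpha> by (simp add: field_simps)
  then obtain \<beta> where \<beta>: "cmod \<beta> = 1" "(1 - \<beta>) * (1 - (1 - \<alpha>) * of_real p) = 1"
    by (rule phase_solving_half_plane)
  have "(cmod (\<alpha> - 1))\<^sup>2 = (cmod \<alpha>)\<^sup>2 + 1 - 2 * Re \<alpha>"
    by (simp add: cmod_power2) (simp add: power2_eq_square algebra_simps)
  then have "(cmod (\<alpha> - 1))\<^sup>2 * p = 1" using \<alpha> assms by (simp add: field_simps)
  with \<alpha>(1) \<beta> show ?thesis by (intro that[of \<alpha> \<beta>]) simp_all
qed

subsection \<open>Circuits calling a circuit and its adjoint\<close>

text \<open>Here \<open>V x\<close> is the matrix of the circuit on input \<open>x\<close>,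
  \<open>\<xi> x\<close> its initial state and \<open>\<eta> x\<close> the content of the ancillae.
  The matrix \<open>M\<close> does not depend on \<open>x\<close>, so its phases are admissible
  plain gates; yet next to \<open>\<eta> x\<close> it acts as the projector onto the ray of
  \<open>\<xi> x\<close>.\<close>

locale calling_circuits =
  fixes n a :: nat and X :: "'x set" and V :: "'x \<Rightarrow> complex mat"
    and \<xi> \<eta> :: "'x \<Rightarrow> complex vec" and M :: "complex mat"
  assumes V: "x \<in> X \<Longrightarrow> unitary_mat (2 ^ n) (V x)"
    and \<xi>: "x \<in> X \<Longrightarrow> state (2 ^ n) (\<xi> x)"
    and \<eta>: "x \<in> X \<Longrightarrow> state (2 ^ a) (\<eta> x)"
    and M: "projector (2 ^ (n + a)) M"
    and M_kron: "x \<in> X \<Longrightarrow> u \<in> carrier_vec (2 ^ n) \<Longrightarrow>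
      M *\<^sub>v kron_vec u (\<eta> x) = (u \<bullet>c \<xi> x) \<cdot>\<^sub>v kron_vec (\<xi> x) (\<eta> x)"
begin

abbreviation run :: "call_gate list \<Rightarrow> 'x \<Rightarrow> complex mat" where
  "run L x \<equiv> compose_mats (2 ^ (n + a)) (map (call_gate_mat a (V x)) L)"

abbreviation valid :: "call_gate list \<Rightarrow> bool" where
  "valid L \<equiv> \<forall>g\<in>set L. valid_call_gate (n + a) g"

lemma call_gate_mat_carrier:
  assumes "x \<in> X" "valid_call_gate (n + a) g"
  shows "call_gate_mat a (V x) g \<in> carrier_mat (2 ^ (n + a)) (2 ^ (n + a))"
  using assms unitary_mat_carrier[OF V[OF assms(1)]]
    kron_mat_carrier[of "V x" "2 ^ n" "2 ^ n" "1\<^sub>m (2 ^ a)" "2 ^ a" "2 ^ a"]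
    kron_mat_carrier[of "mat_adjoint (V x)" "2 ^ n" "2 ^ n" "1\<^sub>m (2 ^ a)" "2 ^ a" "2 ^ a"]
  by (cases g) (auto simp: unitary_mat_carrier power_add)

lemma kron_ancilla_carrier:
  "x \<in> X \<Longrightarrow> u \<in> carrier_vec (2 ^ n) \<Longrightarrow> kron_vec u (\<eta> x) \<in> carrier_vec (2 ^ (n + a))"
  using \<eta> kron_vec_carrier[of u "2 ^ n" "\<eta> x" "2 ^ a"] by (auto simp: state_def power_add)

lemma run_append:
  assumes "x \<in> X" "valid L" "valid L'" "v \<in> carrier_vec (2 ^ (n + a))"
  shows "run (L @ L') x *\<^sub>v v = run L' x *\<^sub>v (run L x *\<^sub>v v)"
  unfolding map_append using assms call_gate_mat_carrier[OF assms(1)]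
  by (intro compose_mats_append_vec) auto

lemma run_single:
  assumes "x \<in> X" "valid_call_gate (n + a) g"
  shows "run [g] x = call_gate_mat a (V x) g"
  using call_gate_mat_carrier[OF assms] by simp

text \<open>The ancillae are returned in the state \<open>\<eta> x\<close>, and \<open>u\<close>
  ranges over all vectors and not only the initial state; this is what makes realizations
  composable.\<close>

definition realizes :: "call_gate list \<Rightarrow> ('x \<Rightarrow> complex mat) \<Rightarrow> bool" where
  "realizes L W \<longleftrightarrow> valid L \<and> (\<forall>x\<in>X. unitary_mat (2 ^ n) (W x) \<and>
     (\<forall>u\<in>carrier_vec (2 ^ n). run L x *\<^sub>v kron_vec u (\<eta> x) = kron_vec (W x *\<^sub>v u) (\<eta> x)))"

text \<open>An amplification round calls the adjoint of the previous round, so both directions are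
  carried along.\<close>

definition reversibly_realizable :: "('x \<Rightarrow> complex mat) \<Rightarrow> bool" where
  "reversibly_realizable W \<longleftrightarrow> (\<exists>L. realizes L W) \<and> (\<exists>L. realizes L (\<lambda>x. mat_adjoint (W x)))"

lemma realizes_mult:
  assumes "realizes L W" "realizes L' W'"
  shows "realizes (L @ L') (\<lambda>x. W' x * W x)"
  unfolding realizes_def
proof (intro conjI ballI)
  show "valid_call_gate (n + a) g" if "g \<in> set (L @ L')" for g
    using that assms by (auto simp: realizes_def)
next
  fix x assume x: "x \<in> X"
  have U: "unitary_mat (2 ^ n) (W x)" "unitary_mat (2 ^ n) (W' x)"
    using assms x by (auto simp: realizes_def)
  then show "unitary_mat (2 ^ n) (W' x * W x)" by (intro unitary_mat_mult)
  fix u :: "complex vec" assume u: "u \<in> carrier_vec (2 ^ n)"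
  note c = unitary_mat_carrier[OF U(1)] unitary_mat_carrier[OF U(2)]
  have "run (L @ L') x *\<^sub>v kron_vec u (\<eta> x) = run L' x *\<^sub>v (run L x *\<^sub>v kron_vec u (\<eta> x))"
    using assms x u kron_ancilla_carrier by (intro run_append) (auto simp: realizes_def)
  also have "\<dots> = kron_vec (W' x *\<^sub>v (W x *\<^sub>v u)) (\<eta> x)"
    using assms x u mult_mat_vec_carrier[OF c(1) u] by (simp add: realizes_def)
  also have "W' x *\<^sub>v (W x *\<^sub>v u) = W' x * W x *\<^sub>v u"
    by (rule assoc_mult_mat_vec[OF c(2,1) u, symmetric])
  finally show "run (L @ L') x *\<^sub>v kron_vec u (\<eta> x) = kron_vec (W' x * W x *\<^sub>v u) (\<eta> x)" .
qed

lemma realizes_single: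
  assumes "valid_call_gate (n + a) g"
    and "\<And>x. x \<in> X \<Longrightarrow> unitary_mat (2 ^ n) (W x)"
    and "\<And>x u. x \<in> X \<Longrightarrow> u \<in> carrier_vec (2 ^ n) \<Longrightarrow>
      call_gate_mat a (V x) g *\<^sub>v kron_vec u (\<eta> x) = kron_vec (W x *\<^sub>v u) (\<eta> x)"
  shows "realizes [g] W"
  using assms run_single[OF _ assms(1)] by (auto simp: realizes_def simp del: compose_mats.simps list.map)

lemma realizes_call: "realizes [Call] V"
proof (rule realizes_single)
  fix x and u :: "complex vec" assume "x \<in> X" "u \<in> carrier_vec (2 ^ n)"
  then show "call_gate_mat a (V x) Call *\<^sub>v kron_vec u (\<eta> x) = kron_vec (V x *\<^sub>v u) (\<eta> x)"
    using \<eta> unitary_mat_carrier[OF V] by (simp add: state_def kron_mat_vec[of _ "2 ^ n" _ "2 ^ a"])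
qed (auto intro: V)

lemma realizes_call_adjoint: "realizes [Call_adjoint] (\<lambda>x. mat_adjoint (V x))"
proof (rule realizes_single)
  fix x and u :: "complex vec" assume "x \<in> X" "u \<in> carrier_vec (2 ^ n)"
  then show "call_gate_mat a (V x) Call_adjoint *\<^sub>v kron_vec u (\<eta> x) = kron_vec (mat_adjoint (V x) *\<^sub>v u) (\<eta> x)"
    using \<eta> unitary_mat_carrier[OF V] by (simp add: state_def kron_mat_vec[of _ "2 ^ n" _ "2 ^ a"])
qed (auto intro: V unitary_mat_adjoint)

text \<open>A phase is affine in its projector, so the agreement of \<open>T\<close> with
  \<open>S x\<close> next to \<open>\<eta> x\<close> passes to their phases, even though the gate
  itself is the same for all inputs.\<close>

lemma realizes_phase:
  assumes T: "projector (2 ^ (n + a)) T" and \<alpha>: "cmod \<alpha> = 1"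
    and S: "\<And>x. x \<in> X \<Longrightarrow> projector (2 ^ n) (S x)"
    and TS: "\<And>x u. x \<in> X \<Longrightarrow> u \<in> carrier_vec (2 ^ n) \<Longrightarrow>
      T *\<^sub>v kron_vec u (\<eta> x) = kron_vec (S x *\<^sub>v u) (\<eta> x)"
  shows "realizes [Plain (phase_mat (2 ^ (n + a)) \<alpha> T)] (\<lambda>x. phase_mat (2 ^ n) \<alpha> (S x))"
proof (rule realizes_single)
  fix x and u :: "complex vec" assume x: "x \<in> X" and u: "u \<in> carrier_vec (2 ^ n)"
  have Su: "S x *\<^sub>v u \<in> carrier_vec (2 ^ n)"
    using mult_mat_vec_carrier[OF projector_carrier[OF S[OF x]] u] .
  then show "call_gate_mat a (V x) (Plain (phase_mat (2 ^ (n + a)) \<alpha> T)) *\<^sub>v kron_vec u (\<eta> x)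
      = kron_vec (phase_mat (2 ^ n) \<alpha> (S x) *\<^sub>v u) (\<eta> x)"
    using x u TS projector_carrier[OF T] projector_carrier[OF S[OF x]] kron_ancilla_carrier
    by (simp add: phase_mat_vec kron_vec_minus_smult)
qed (use T \<alpha> S in \<open>auto intro: unitary_phase_mat\<close>)

lemma reversibly_realizable_mult:
  assumes "reversibly_realizable W" "reversibly_realizable W'"
  shows "reversibly_realizable (\<lambda>x. W' x * W x)"
proof -
  obtain L K where L: "realizes L W" "realizes K (\<lambda>x. mat_adjoint (W x))"
    using assms(1) by (auto simp: reversibly_realizable_def)
  obtain L' K' where L': "realizes L' W'" "realizes K' (\<lambda>x. mat_adjoint (W' x))"
    using assms(2) by (auto simp: reversibly_realizable_def)
  have adj: "mat_adjoint (W' x * W x) = mat_adjoint (W x) * mat_adjoint (W' x)" if "x \<in> X" for x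
    using L L' that unitary_mat_carrier
    by (intro mat_adjoint_mult[of _ "2 ^ n" "2 ^ n" _ "2 ^ n"]) (auto simp: realizes_def)
  \<comment> \<open>The adjoint of a product reverses the order, so the adjoint of the later factor
    is run first.\<close>
  have "realizes (K' @ K) (\<lambda>x. mat_adjoint (W' x * W x))"
    using realizes_mult[OF L'(2) L(2)] by (simp add: realizes_def adj)
  then show ?thesis
    using realizes_mult[OF L(1) L'(1)] by (auto simp: reversibly_realizable_def)
qed

lemma reversibly_realizable_adjoint:
  "reversibly_realizable W \<Longrightarrow> reversibly_realizable (\<lambda>x. mat_adjoint (W x))"
  by (auto simp: reversibly_realizable_def)

lemma reversibly_realizable_call: "reversibly_realizable V"
  using realizes_call realizes_call_adjoint by (auto simp: reversibly_realizable_def)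

lemma reversibly_realizable_phase:
  assumes "projector (2 ^ (n + a)) T" "cmod \<alpha> = 1"
    and S: "\<And>x. x \<in> X \<Longrightarrow> projector (2 ^ n) (S x)"
    and "\<And>x u. x \<in> X \<Longrightarrow> u \<in> carrier_vec (2 ^ n) \<Longrightarrow>
      T *\<^sub>v kron_vec u (\<eta> x) = kron_vec (S x *\<^sub>v u) (\<eta> x)"
  shows "reversibly_realizable (\<lambda>x. phase_mat (2 ^ n) \<alpha> (S x))"
proof -
  \<comment> \<open>The adjoint of a phase is the phase with \<open>cnj \<alpha>\<close>, again of
    modulus one, so a single construction serves both directions.\<close>
  have "\<exists>L. realizes L (\<lambda>x. phase_mat (2 ^ n) \<beta> (S x))" if "cmod \<beta> = 1" for \<beta>
    using realizes_phase[OF assms(1) that S assms(4)] by blast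
  from this[of \<alpha>] this[of "cnj \<alpha>"] show ?thesis
    using assms(2) S by (auto simp: reversibly_realizable_def realizes_def phase_mat_adjoint)
qed

lemma reversibly_realizable_amplify:
  assumes R: "projector (2 ^ n) R" and W: "reversibly_realizable W" and "cmod \<alpha> = 1" "cmod \<beta> = 1"
  shows "reversibly_realizable (\<lambda>x. amplify (2 ^ n) R (\<xi> x) \<alpha> \<beta> (W x))"
proof -
  have "reversibly_realizable (\<lambda>x. phase_mat (2 ^ n) \<alpha> R)"
  proof (rule reversibly_realizable_phase[of "kron_mat R (1\<^sub>m (2 ^ a))"])
    show "projector (2 ^ (n + a)) (kron_mat R (1\<^sub>m (2 ^ a)))"
      using projector_kron_mat[OF R projector_one[of "2 ^ a"]] by (simp add: power_add)
    fix x and u :: "complex vec" assume "x \<in> X" "u \<in> carrier_vec (2 ^ n)"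
    then show "kron_mat R (1\<^sub>m (2 ^ a)) *\<^sub>v kron_vec u (\<eta> x) = kron_vec (R *\<^sub>v u) (\<eta> x)"
      using \<eta> projector_carrier[OF R] by (simp add: state_def kron_mat_vec[of _ "2 ^ n" _ "2 ^ a"])
  qed (use assms in auto)
  \<comment> \<open>The ray projector depends on the input; the fixed matrix \<open>M\<close> stands
    in for it.\<close>
  moreover have "reversibly_realizable (\<lambda>x. phase_mat (2 ^ n) \<beta> (ray_projector (2 ^ n) (\<xi> x)))"
  proof (rule reversibly_realizable_phase[OF M])
    fix x and u :: "complex vec" assume x: "x \<in> X" and u: "u \<in> carrier_vec (2 ^ n)"
    have "kron_vec (c \<cdot>\<^sub>v \<xi> x) (\<eta> x) = c \<cdot>\<^sub>v kron_vec (\<xi> x) (\<eta> x)" for c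
      using \<xi>[OF x] by (intro eq_vecI) (auto simp: kron_vec_def less_mult_imp_div_less)
    then show "M *\<^sub>v kron_vec u (\<eta> x) = kron_vec (ray_projector (2 ^ n) (\<xi> x) *\<^sub>v u) (\<eta> x)"
      using x u \<xi> by (simp add: M_kron ray_projector_vec)
  qed (use assms \<xi> in \<open>auto intro: projector_ray_projector\<close>)
  ultimately show ?thesis
    unfolding amplify_def
    using W by (intro reversibly_realizable_mult reversibly_realizable_adjoint)
qed

section \<open>From circuits to achievable outcome probabilities\<close>

definition achieves :: "complex mat \<Rightarrow> ('x \<Rightarrow> real) \<Rightarrow> bool" where
  "achieves R f \<longleftrightarrow>
     (\<exists>W. reversibly_realizable W \<and> (\<forall>x\<in>X. outcome_prob R (W x *\<^sub>v \<xi> x) = f x))"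

lemma achieves_cong: "achieves R f \<Longrightarrow> (\<And>x. x \<in> X \<Longrightarrow> f x = g x) \<Longrightarrow> achieves R g"
  by (auto simp: achieves_def)

lemma achieves_complement:
  assumes "projector (2 ^ n) R" "achieves R f"
  shows "achieves (1\<^sub>m (2 ^ n) - R) (\<lambda>x. 1 - f x)"
proof -
  obtain W where W: "reversibly_realizable W" "\<And>x. x \<in> X \<Longrightarrow> outcome_prob R (W x *\<^sub>v \<xi> x) = f x"
    using assms(2) by (auto simp: achieves_def)
  then have "outcome_prob (1\<^sub>m (2 ^ n) - R) (W x *\<^sub>v \<xi> x) = 1 - f x" if "x \<in> X" for x
    using that outcome_prob_complement[OF assms(1) unitary_mat_state[OF _ \<xi>[OF that]], of "W x"]
    by (auto simp: reversibly_realizable_def realizes_def)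
  with W(1) show ?thesis by (auto simp: achieves_def)
qed

lemma achieves_amplify:
  assumes R: "projector (2 ^ n) R" and "achieves R f" and "cmod \<alpha> = 1" "cmod \<beta> = 1"
  shows "achieves R (\<lambda>x. (cmod (\<alpha> - (1 - \<beta>) * (1 - (1 - \<alpha>) * of_real (f x))))\<^sup>2 * f x)"
proof -
  obtain W where W: "reversibly_realizable W" "\<And>x. x \<in> X \<Longrightarrow> outcome_prob R (W x *\<^sub>v \<xi> x) = f x"
    using assms(2) by (auto simp: achieves_def)
  have "outcome_prob R (amplify (2 ^ n) R (\<xi> x) \<alpha> \<beta> (W x) *\<^sub>v \<xi> x)
      = (cmod (\<alpha> - (1 - \<beta>) * (1 - (1 - \<alpha>) * of_real (f x))))\<^sup>2 * f x" if "x \<in> X" for x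
    using outcome_prob_amplify[OF R _ \<xi>[OF that], of "W x"] W that
    by (auto simp: reversibly_realizable_def realizes_def)
  then show ?thesis
    using reversibly_realizable_amplify[OF R W(1) assms(3,4)] unfolding achieves_def by blast
qed

text \<open>The phases are tuned to \<open>q\<close>. Since \<open>p\<close> is a different value,
  its coefficient is nonzero, and \<open>0 < p\<close> keeps the new probability positive.\<close>

lemma achieves_annihilate:
  assumes R: "projector (2 ^ n) R" and f: "achieves R (\<lambda>x. if \<Psi> x then p else q)"
    and "0 \<le> q" "q \<le> 3 / 4" "0 < p" "p \<noteq> q"
  obtains r where "0 < r" "achieves R (\<lambda>x. if \<Psi> x then r else 0)"
proof -
  obtain \<alpha> \<beta> where ph: "cmod \<alpha> = 1" "cmod \<beta> = 1"
    and z: "\<And>p. \<alpha> - (1 - \<beta>) * (1 - (1 - \<alpha>) * of_real p) = 0 \<longleftrightarrow> p = q"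
    using annihilating_phases[OF assms(3,4)] by metis
  let ?r = "(cmod (\<alpha> - (1 - \<beta>) * (1 - (1 - \<alpha>) * of_real p)))\<^sup>2 * p"
  have "0 < ?r" using z[of p] assms by simp
  moreover have "achieves R (\<lambda>x. if \<Psi> x then ?r else 0)"
    using z[of q] by (intro achieves_cong[OF achieves_amplify[OF R f ph]]) auto
  ultimately show ?thesis by (rule that)
qed

text \<open>With both phases -1 a round sends \<open>r\<close> to
  \<open>(3 - 4 * r)\<^sup>2 * r\<close>, the tripling of the angle when \<open>r\<close> is a
  squared sine, and leaves 0 at 0. Below 1/4 this gains a factor of at least 4, so \<open>k\<close>
  bounds the number of rounds.\<close>

lemma achieves_boost:
  assumes R: "projector (2 ^ n) R" and "achieves R (\<lambda>x. if \<Psi> x then r else 0)" "0 < r" "1 \<le> 4 ^ k * r"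
  shows "\<exists>r'\<ge>1 / 4. achieves R (\<lambda>x. if \<Psi> x then r' else 0)"
  using assms(2-)
proof (induction k arbitrary: r)
  case 0
  then show ?case by (intro exI[of _ r]) auto
next
  case (Suc k)
  show ?case
  proof (cases "r \<ge> 1 / 4")
    case False
    have norm: "cmod (- 1 - (1 - - 1) * (1 - (1 - - 1) * of_real p)) = \<bar>3 - 4 * p\<bar>" for p :: real
    proof -
      have "- 1 - (1 - - 1) * (1 - (1 - - 1) * complex_of_real p) = of_real (- (3 - 4 * p))" by simp
      then show ?thesis by (simp only: norm_of_real abs_minus_cancel)
    qed
    have "4 \<le> (3 - 4 * r)\<^sup>2"
      using power_mono[of 2 "3 - 4 * r" 2] False by simp
    then have grow: "4 * r \<le> (3 - 4 * r)\<^sup>2 * r" using Suc.prems by (intro mult_right_mono) auto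
    have "achieves R (\<lambda>x. if \<Psi> x then (3 - 4 * r)\<^sup>2 * r else 0)"
      using achieves_amplify[OF R Suc.prems(1), of "-1" "-1"]
      unfolding norm power2_abs by (rule achieves_cong) auto
    moreover have "0 < (3 - 4 * r)\<^sup>2 * r" using grow Suc.prems by linarith
    moreover have "1 \<le> 4 ^ k * ((3 - 4 * r)\<^sup>2 * r)"
    proof -
      have "1 \<le> 4 ^ k * (4 * r)" using Suc.prems by simp
      also have "\<dots> \<le> 4 ^ k * ((3 - 4 * r)\<^sup>2 * r)" using grow by (rule mult_left_mono) simp
      finally show ?thesis .
    qed
    ultimately show ?thesis by (rule Suc.IH)
  qed (use Suc.prems in auto)
qed

lemma achieves_certainty_aux:
  assumes R: "projector (2 ^ n) R" and "achieves R (\<lambda>x. if \<Psi> x then p else q)"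
    and "0 \<le> q" "q \<le> 3 / 4" "0 < p" "p \<noteq> q"
  shows "achieves R (\<lambda>x. if \<Psi> x then 1 else 0)"
proof -
  obtain r where r: "0 < r" "achieves R (\<lambda>x. if \<Psi> x then r else 0)"
    using achieves_annihilate[OF assms] by blast
  \<comment> \<open>The number of rounds depends only on \<open>r\<close>, which is common to all
    inputs in question.\<close>
  obtain k where "1 / r < 4 ^ k" using real_arch_pow[of 4 "1 / r"] by auto
  then have "1 \<le> 4 ^ k * r" using r(1) by (simp add: field_simps)
  then obtain r' where r': "1 / 4 \<le> r'" "achieves R (\<lambda>x. if \<Psi> x then r' else 0)"
    using achieves_boost[OF R r(2,1)] by blast
  \<comment> \<open>The last round takes \<open>r'\<close> to 1; the value 0 survives because it is
    a factor of the new probability.\<close>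
  obtain \<alpha> \<beta> where ph: "cmod \<alpha> = 1" "cmod \<beta> = 1"
    and "(cmod (\<alpha> - (1 - \<beta>) * (1 - (1 - \<alpha>) * of_real r')))\<^sup>2 * r' = 1"
    using saturating_phases[OF r'(1)] by metis
  then show ?thesis
    by (intro achieves_cong[OF achieves_amplify[OF R r'(2) ph]]) auto
qed

lemma achieves_certainty:
  assumes R: "projector (2 ^ n) R" and f: "achieves R (\<lambda>x. if \<Psi> x then p else q)"
    and "0 \<le> q" "q < p" "p \<le> 1"
  shows "achieves R (\<lambda>x. if \<Psi> x then 1 else 0)"
proof (cases "q \<le> 3 / 4")
  case True
  with assms show ?thesis by (intro achieves_certainty_aux[OF R f]) auto
next
  case False
  let ?R = "1\<^sub>m (2 ^ n) - R"
  have R': "projector (2 ^ n) ?R" using R by (rule projector_complement)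
  \<comment> \<open>In the complementary outcome the two classes swap roles: \<open>1 - p\<close>,
    now below 1/4, is annihilated and the positive \<open>1 - q\<close> is raised to 1.\<close>
  have "achieves ?R (\<lambda>x. if \<not> \<Psi> x then 1 - q else 1 - p)"
    by (rule achieves_cong[OF achieves_complement[OF R f]]) auto
  then have "achieves ?R (\<lambda>x. if \<not> \<Psi> x then 1 else 0)"
    using assms False by (intro achieves_certainty_aux[OF R', of "\<lambda>x. \<not> \<Psi> x" "1 - q" "1 - p"]) auto
  from achieves_complement[OF R' this]
  have "achieves (1\<^sub>m (2 ^ n) - ?R) (\<lambda>x. if \<Psi> x then 1 else 0)"
    by (rule achieves_cong) auto
  moreover have "1\<^sub>m (2 ^ n) - ?R = R"
    by (rule eq_matI) (use projector_carrier[OF R] in auto)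
  ultimately show ?thesis by simp
qed

end

subsection \<open>Access to the initial state\<close>

lemma permutation_mat_vec:
  assumes "\<And>i. i < d \<Longrightarrow> \<sigma> i < d" "\<And>i. i < d \<Longrightarrow> \<sigma> (\<sigma> i) = i" "v \<in> carrier_vec d" "i < d"
  shows "(mat d d (\<lambda>(i, j). of_bool (i = \<sigma> j)) *\<^sub>v v) $ i = (v $ \<sigma> i :: complex)"
proof -
  have "(mat d d (\<lambda>(i, j). of_bool (i = \<sigma> j)) *\<^sub>v v) $ i = (\<Sum>j<d. of_bool (i = \<sigma> j) * v $ j)"
    using assms(3,4) by (subst mult_mat_vec_sum[where d = d]) auto
  also have "\<dots> = (\<Sum>j<d. if j = \<sigma> i then v $ j else 0)"
  proof (rule sum.cong)
    fix j assume "j \<in> {..<d}"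
    then have "i = \<sigma> j \<longleftrightarrow> j = \<sigma> i" using assms(2)[of j] assms(2)[OF assms(4)] by auto
    then show "of_bool (i = \<sigma> j) * v $ j = (if j = \<sigma> i then v $ j else 0)" by simp
  qed simp
  also have "\<dots> = v $ \<sigma> i" using assms by simp
  finally show ?thesis .
qed

text \<open>Controlled on the encoded input \<open>y\<close>, the ancilla basis states \<open>0\<close> and \<open>y\<close> are exchanged.\<close>

lemma copy_input_unitary:
  fixes \<phi> :: "complex vec"
  assumes \<phi>: "\<phi> \<in> carrier_vec e"
  obtains K where "unitary_mat (d * e * d) K"
    "\<And>y. y < d \<Longrightarrow> K *\<^sub>v kron_vec (kron_vec (unit_vec d y) \<phi>) (unit_vec d 0)
       = kron_vec (kron_vec (unit_vec d y) \<phi>) (unit_vec d y)"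
proof -
  \<comment> \<open>An index is \<open>(y * e + w) * d + c\<close> with input \<open>y\<close>,
    remaining qubits \<open>w\<close> and ancilla \<open>c\<close>. Only \<open>c\<close> changes
    while \<open>y\<close> controls the exchange, so \<open>\<sigma>\<close> is an
    involution.\<close>
  define \<sigma> where "\<sigma> i = i div d * d + Transposition.transpose 0 (i div d div e) (i mod d)" for i
  have rng: "Transposition.transpose 0 (i div d div e) (i mod d) < d" if "i < d * e * d" for i
    using div_mod_less[of i "d * e" d] div_mod_less[of "i div d" d e] that
    by (auto simp: Transposition.transpose_def)
  have sdiv: "\<sigma> i div d = i div d"
    and smod: "\<sigma> i mod d = Transposition.transpose 0 (i div d div e) (i mod d)" if "i < d * e * d" for i
    using rng[OF that] by (auto simp: \<sigma>_def)
  have lt: "\<sigma> i < d * e * d" if "i < d * e * d" for i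
  proof -
    have "\<sigma> i div d < d * e" using sdiv[OF that] div_mod_less(1)[OF that] by simp
    moreover have "d > 0" using that by (cases "d = 0") auto
    ultimately show ?thesis by (simp add: div_less_iff_less_mult)
  qed
  have inv: "\<sigma> (\<sigma> i) = i" if "i < d * e * d" for i
    using sdiv[OF that] smod[OF that] unfolding \<sigma>_def[of "\<sigma> i"] by simp
  define K where "K = mat (d * e * d) (d * e * d) (\<lambda>(i, j). of_bool (i = \<sigma> j) :: complex)"
  have "K *\<^sub>v kron_vec (kron_vec (unit_vec d y) \<phi>) (unit_vec d 0)
      = kron_vec (kron_vec (unit_vec d y) \<phi>) (unit_vec d y)" if y: "y < d" for y
  proof (rule eq_vecI)
    fix i assume "i < dim_vec (kron_vec (kron_vec (unit_vec d y) \<phi>) (unit_vec d y))"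
    then have i: "i < d * e * d" using \<phi> by (simp add: kron_vec_def)
    note b = div_mod_less[OF i] div_mod_less[OF div_mod_less(1)[OF i]]
    have c: "kron_vec (kron_vec (unit_vec d y) \<phi>) (unit_vec d 0) \<in> carrier_vec (d * e * d)"
      using \<phi> by simp
    have "(K *\<^sub>v kron_vec (kron_vec (unit_vec d y) \<phi>) (unit_vec d 0)) $ i
        = kron_vec (kron_vec (unit_vec d y) \<phi>) (unit_vec d 0) $ \<sigma> i"
      unfolding K_def by (rule permutation_mat_vec[OF lt inv c i])
    also have "\<dots> = kron_vec (kron_vec (unit_vec d y) \<phi>) (unit_vec d y) $ i"
      using i lt[OF i] b \<phi> y rng[OF i]
      by (auto simp: kron_vec_def sdiv smod Transposition.transpose_def)
    finally show "(K *\<^sub>v kron_vec (kron_vec (unit_vec d y) \<phi>) (unit_vec d 0)) $ i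
        = kron_vec (kron_vec (unit_vec d y) \<phi>) (unit_vec d y) $ i" .
  qed (use \<phi> in \<open>simp add: kron_vec_def K_def\<close>)
  moreover have "unitary_mat (d * e * d) K"
    unfolding K_def using lt inv by (rule unitary_mat_involution)
  ultimately show ?thesis by (intro that)
qed

text \<open>The labels make the vectors \<open>kron_vec (z y) (unit_vec e y)\<close> orthonormal
  even when the \<open>z y\<close> are not orthogonal, and a vector with label \<open>y\<close>
  overlaps only with the member of that label.\<close>

lemma labelled_states_projector:
  assumes "\<And>y. y < e \<Longrightarrow> state d (z y)"
  obtains M where "projector (d * e) M"
    "\<And>y u. y < e \<Longrightarrow> u \<in> carrier_vec d \<Longrightarrow>
       M *\<^sub>v kron_vec u (unit_vec e y) = (u \<bullet>c z y) \<cdot>\<^sub>v kron_vec (z y) (unit_vec e y)"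
proof -
  let ?z = "\<lambda>y. kron_vec (z y) (unit_vec e y)"
  have c: "z y \<in> carrier_vec d" if "y < e" for y using assms[OF that] by (simp add: state_def)
  have ip: "kron_vec u (unit_vec e y) \<bullet>c ?z y' = (u \<bullet>c z y') * of_bool (y = y')"
    if "y < e" "y' < e" "u \<in> carrier_vec d" for y y' u
    using that c by (simp add: kron_vec_cscalar_prod[of _ d _ _ e] unit_vec_cscalar_prod)
  have "projector (d * e) (span_projector (d * e) {..<e} ?z)"
    using c assms by (intro projector_span_projector) (auto simp: ip state_def)
  moreover have "span_projector (d * e) {..<e} ?z *\<^sub>v kron_vec u (unit_vec e y) = (u \<bullet>c z y) \<cdot>\<^sub>v ?z y"
    if "y < e" "u \<in> carrier_vec d" for y u
    using span_projector_single_overlap[of "{..<e}" ?z "d * e" "kron_vec u (unit_vec e y)" y] that c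
    by (simp add: ip)
  ultimately show ?thesis by (rule that)
qed

text \<open>An encoded input is copied into \<open>m\<close> ancillae by \<open>K\<close>, and the
  copy serves as the label. With an oracle the initial state is the same for all inputs, so no
  ancilla is required.\<close>

lemma input_reflection:
  assumes "valid_input n X s \<phi>"
  obtains a K \<eta> M where "unitary_mat (2 ^ (n + a)) K"
    "\<And>x. x \<in> X \<Longrightarrow> K *\<^sub>v kron_vec (initial_state s \<phi> x) (unit_vec (2 ^ a) 0) = kron_vec (initial_state s \<phi> x) (\<eta> x)"
    "\<And>x. x \<in> X \<Longrightarrow> state (2 ^ a) (\<eta> x)" "projector (2 ^ (n + a)) M"
    "\<And>x u. x \<in> X \<Longrightarrow> u \<in> carrier_vec (2 ^ n) \<Longrightarrow>
      M *\<^sub>v kron_vec u (\<eta> x) = (u \<bullet>c initial_state s \<phi> x) \<cdot>\<^sub>v kron_vec (initial_state s \<phi> x) (\<eta> x)"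
proof (cases s)
  case (Encoded m enc)
  then have m: "m \<le> n" and enc: "\<And>x. x \<in> X \<Longrightarrow> enc x < 2 ^ m" and \<phi>: "state (2 ^ (n - m)) \<phi>"
    using assms by auto
  have dim: "2 ^ m * 2 ^ (n - m) = (2 :: nat) ^ n" "2 ^ m * 2 ^ (n - m) * 2 ^ m = (2 :: nat) ^ (n + m)"
    using m by (simp_all add: power_add[symmetric])
  have \<phi>': "\<phi> \<in> carrier_vec (2 ^ (n - m))" using \<phi> by (simp add: state_def)
  obtain K where K: "unitary_mat (2 ^ m * 2 ^ (n - m) * 2 ^ m) K"
    "\<And>y. y < 2 ^ m \<Longrightarrow> K *\<^sub>v kron_vec (kron_vec (unit_vec (2 ^ m) y) \<phi>) (unit_vec (2 ^ m) 0)
       = kron_vec (kron_vec (unit_vec (2 ^ m) y) \<phi>) (unit_vec (2 ^ m) y)"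
    using copy_input_unitary[OF \<phi>', of "2 ^ m"] by metis
  have "state (2 ^ n) (kron_vec (unit_vec (2 ^ m) y) \<phi>)" if "y < 2 ^ m" for y
    using kron_vec_state[OF state_unit_vec[OF that] \<phi>] by (simp only: dim)
  then obtain M where M: "projector (2 ^ n * 2 ^ m) M"
    "\<And>y u. y < 2 ^ m \<Longrightarrow> u \<in> carrier_vec (2 ^ n) \<Longrightarrow>
       M *\<^sub>v kron_vec u (unit_vec (2 ^ m) y)
       = (u \<bullet>c kron_vec (unit_vec (2 ^ m) y) \<phi>) \<cdot>\<^sub>v kron_vec (kron_vec (unit_vec (2 ^ m) y) \<phi>) (unit_vec (2 ^ m) y)"
    using labelled_states_projector[of "2 ^ m" "2 ^ n" "\<lambda>y. kron_vec (unit_vec (2 ^ m) y) \<phi>"] by metis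
  show ?thesis
    by (rule that[of m K "\<lambda>x. unit_vec (2 ^ m) (enc x)" M])
      (use K[unfolded dim(2)] M enc Encoded in \<open>auto simp: power_add state_unit_vec\<close>)
next
  case (Oracle q f)
  then have \<phi>: "state (2 ^ n) \<phi>" using assms by simp
  then obtain M where M: "projector (2 ^ n * 1) M"
    "\<And>y u. y < 1 \<Longrightarrow> u \<in> carrier_vec (2 ^ n) \<Longrightarrow>
       M *\<^sub>v kron_vec u (unit_vec 1 y) = (u \<bullet>c \<phi>) \<cdot>\<^sub>v kron_vec \<phi> (unit_vec 1 y)"
    using labelled_states_projector[of 1 "2 ^ n" "\<lambda>_. \<phi>"] by metis
  have "kron_vec \<phi> (unit_vec 1 0) \<in> carrier_vec (2 ^ n)"
    using \<phi> kron_vec_carrier[of \<phi> "2 ^ n" "unit_vec 1 0" 1] by (simp add: state_def)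
  then show ?thesis
    \<comment> \<open>Zero ancillae form a space of dimension \<open>2 ^ 0 = 1\<close>, with the
      single basis vector \<open>unit_vec 1 0\<close> and nothing to copy.\<close>
    by (intro that[of 0 "1\<^sub>m (2 ^ n)" "\<lambda>_. unit_vec 1 0" M])
      (use M Oracle in \<open>auto simp: unitary_mat_one state_unit_vec\<close>)
qed

section \<open>The two known outcome probabilities and the final circuit\<close>

lemma outcome_prob_values:
  assumes \<delta>\<epsilon>: "\<delta> < \<epsilon>" and P: "projector d P" and E: "Eg \<in> outcomes d P" "Eb \<in> outcomes d P"
    and out: "\<And>x. x \<in> X \<Longrightarrow> state d (out x)"
    and err: "two_sided_exact_error out X \<Phi> Eg Eb \<delta> \<epsilon>"
    and nondegenerate: "Eg \<noteq> Eb \<longrightarrow> \<delta> + \<epsilon> \<noteq> 1"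
  obtains p q where "p \<noteq> q" "0 \<le> p" "p \<le> 1" "0 \<le> q" "q \<le> 1"
    "\<And>x. x \<in> X \<Longrightarrow> outcome_prob P (out x) = (if \<Phi> x then p else q)"
proof -
  define p q where "p = (if Eg = P then \<epsilon> else 1 - \<epsilon>)" and "q = (if Eb = P then \<delta> else 1 - \<delta>)"
  \<comment> \<open>If the same outcome is the error on both classes, \<delta> < \<epsilon>
    separates the values. Otherwise they are \<epsilon> and 1 - \<delta>, or 1 - \<epsilon> and
    \<delta>, which coincide exactly when \<delta> + \<epsilon> = 1.\<close>
  have pq: "p \<noteq> q"
    using \<delta>\<epsilon> E nondegenerate by (auto simp: p_def q_def outcomes_def)
  have val: "outcome_prob P (out x) = (if \<Phi> x then p else q)" if "x \<in> X" for x
    using err E that outcome_prob_complement[OF P out[OF that]]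
    by (auto simp: two_sided_exact_error_def outcomes_def p_def q_def)
  have rng: "0 \<le> outcome_prob P (out x)" "outcome_prob P (out x) \<le> 1" if "x \<in> X" for x
    using outcome_prob_projector(3)[OF P] outcome_prob_projector(3)[OF projector_complement[OF P]]
      outcome_prob_complement[OF P out[OF that]] out[OF that] by (force simp: state_def)+
  have good: "0 \<le> p \<and> p \<le> 1" if "x \<in> X" "\<Phi> x" for x using val rng that by force
  have bad: "0 \<le> q \<and> q \<le> 1" if "x \<in> X" "\<not> \<Phi> x" for x using val rng that by force
  \<comment> \<open>The bounds on \<open>p\<close> and \<open>q\<close> come from actual inputs. If
    a class is empty, its value is replaced by 0 or 1, chosen different from the other.\<close>
  consider (both) "0 \<le> p \<and> p \<le> 1" "0 \<le> q \<and> q \<le> 1" | (no_good) "\<forall>x\<in>X. \<not> \<Phi> x" "0 \<le> q \<and> q \<le> 1"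
    | (no_bad) "\<forall>x\<in>X. \<Phi> x" "0 \<le> p \<and> p \<le> 1" | (empty) "X = {}"
    using good bad by blast
  then show ?thesis
  proof cases
    case both
    with pq val show ?thesis by (intro that[of p q]) auto
  next
    case no_good
    with val show ?thesis by (intro that[of "if q = 0 then 1 else 0" q]) auto
  next
    case no_bad
    with val show ?thesis by (intro that[of p "if p = 0 then 1 else 0"]) auto
  next
    case empty
    then show ?thesis by (intro that[of 1 0]) auto
  qed
qed

theorem theorem3:
  fixes X :: "'x set" and \<Phi> :: "'x \<Rightarrow> bool" and \<delta> \<epsilon> :: real
    and n :: nat and s :: "'x input_model" and \<phi> :: "complex vec"
    and C :: "gate list" and P Eg Eb :: "complex mat"
  assumes "\<delta> < \<epsilon>"
    and "valid_input n X s \<phi>"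
    and "\<forall>g\<in>set C. valid_gate n s g"
    and "projector (2 ^ n) P"
    and "Eg \<in> outcomes (2 ^ n) P" and "Eb \<in> outcomes (2 ^ n) P"
    and "two_sided_exact_error (circuit_output n s \<phi> C) X \<Phi> Eg Eb \<delta> \<epsilon>"
    and nondegenerate: "Eg \<noteq> Eb \<longrightarrow> \<delta> + \<epsilon> \<noteq> 1"
  shows "\<exists>a C' Q A.
    (\<forall>g\<in>set C'. valid_call_gate (n + a) g) \<and> Call \<in> set C' \<and> Call_adjoint \<in> set C' \<and>
    projector (2 ^ a) Q \<and> A \<in> outcomes (2 ^ (n + a)) (kron_mat P Q) \<and>
    decides_with_certainty (calling_output n a s \<phi> C C') X \<Phi> A"
proof -
  let ?V = "circuit_mat n s C" and ?\<xi> = "initial_state s \<phi>"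
  have V: "unitary_mat (2 ^ n) (?V x)" for x by (rule unitary_circuit_mat[OF assms(2,3)])
  have \<xi>: "state (2 ^ n) (?\<xi> x)" if "x \<in> X" for x by (rule state_initial_state[OF assms(2) that])
  have out: "state (2 ^ n) (circuit_output n s \<phi> C x)" if "x \<in> X" for x
    unfolding circuit_output_def by (rule unitary_mat_state[OF V \<xi>[OF that]])
  obtain p q where pq: "p \<noteq> q" "0 \<le> p" "p \<le> 1" "0 \<le> q" "q \<le> 1"
    "\<And>x. x \<in> X \<Longrightarrow> outcome_prob P (circuit_output n s \<phi> C x) = (if \<Phi> x then p else q)"
    using outcome_prob_values[OF assms(1,4-6) out assms(7) nondegenerate] by metis
  obtain a K \<eta> M where K: "unitary_mat (2 ^ (n + a)) K"
    "\<And>x. x \<in> X \<Longrightarrow> K *\<^sub>v kron_vec (?\<xi> x) (unit_vec (2 ^ a) 0) = kron_vec (?\<xi> x) (\<eta> x)"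
    and \<eta>: "\<And>x. x \<in> X \<Longrightarrow> state (2 ^ a) (\<eta> x)"
    and M: "projector (2 ^ (n + a)) M"
    "\<And>x u. x \<in> X \<Longrightarrow> u \<in> carrier_vec (2 ^ n) \<Longrightarrow>
      M *\<^sub>v kron_vec u (\<eta> x) = (u \<bullet>c ?\<xi> x) \<cdot>\<^sub>v kron_vec (?\<xi> x) (\<eta> x)"
    using input_reflection[OF assms(2)] by metis
  interpret calling_circuits n a X ?V ?\<xi> \<eta> M
    by unfold_locales (use V \<xi> \<eta> M in auto)
  have P1: "projector (2 ^ (n + a)) (kron_mat P (1\<^sub>m (2 ^ a)))"
    using projector_kron_mat[OF assms(4) projector_one[of "2 ^ a"]] by (simp add: power_add)
  have base: "achieves P (\<lambda>x. if \<Phi> x then p else q)"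
    using reversibly_realizable_call pq(6) unfolding achieves_def circuit_output_def by blast
  \<comment> \<open>Amplification to 1 applies to the class with the larger probability of
    \<open>P\<close>, which may be the good or the bad inputs.\<close>
  obtain \<Psi> where \<Psi>: "achieves P (\<lambda>x. if \<Psi> x then 1 else 0)" "\<Psi> = \<Phi> \<or> \<Psi> = (\<lambda>x. \<not> \<Phi> x)"
  proof (cases "q < p")
    case True
    then show ?thesis using that[of \<Phi>] achieves_certainty[OF assms(4) base] pq by auto
  next
    case False
    have "achieves P (\<lambda>x. if \<not> \<Phi> x then q else p)" by (rule achieves_cong[OF base]) auto
    then show ?thesis
      using False that[of "\<lambda>x. \<not> \<Phi> x"] achieves_certainty[OF assms(4), of "\<lambda>x. \<not> \<Phi> x" q p] pq by auto
  qed
  then obtain W L where W: "realizes L W" "\<And>x. x \<in> X \<Longrightarrow> outcome_prob P (W x *\<^sub>v ?\<xi> x) = (if \<Psi> x then 1 else 0)"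
    unfolding achieves_def reversibly_realizable_def by blast
  \<comment> \<open>First \<open>K\<close> prepares the ancillae. The pair of \<open>Call\<close>
    and \<open>Call_adjoint\<close> cancels and ensures that both occur, whatever \<open>L\<close>
    contains.\<close>
  define C' where "C' = [Plain K] @ ([Call] @ [Call_adjoint]) @ L"
  \<comment> \<open>If \<open>P\<close> has become certain on the bad inputs, the complementary
    outcome is the accepting one.\<close>
  define A where "A = (if \<Psi> = \<Phi> then kron_mat P (1\<^sub>m (2 ^ a)) else 1\<^sub>m (2 ^ (n + a)) - kron_mat P (1\<^sub>m (2 ^ a)))"
  have VV: "realizes ([Call] @ [Call_adjoint]) (\<lambda>x. mat_adjoint (?V x) * ?V x)"
    by (rule realizes_mult[OF realizes_call realizes_call_adjoint])
  have "realizes (([Call] @ [Call_adjoint]) @ L) (\<lambda>x. W x * (mat_adjoint (?V x) * ?V x))"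
    by (rule realizes_mult[OF VV W(1)])
  moreover have WV: "W x * (mat_adjoint (?V x) * ?V x) = W x" if "x \<in> X" for x
    using V[of x] W(1) that unitary_mat_carrier[of "2 ^ n" "W x"] by (auto simp: unitary_mat_def realizes_def)
  ultimately have CL: "realizes (([Call] @ [Call_adjoint]) @ L) W"
    by (simp add: realizes_def)
  have valid: "valid C'" using K(1) W(1) by (auto simp: C'_def realizes_def)
  have final: "calling_output n a s \<phi> C C' x = kron_vec (W x *\<^sub>v ?\<xi> x) (\<eta> x)" if x: "x \<in> X" for x
  proof -
    let ?v = "kron_vec (?\<xi> x) (unit_vec (2 ^ a) 0)"
    have v: "?v \<in> carrier_vec (2 ^ (n + a))"
      using \<xi>[OF x] kron_vec_carrier[of "?\<xi> x" "2 ^ n" "unit_vec (2 ^ a) 0" "2 ^ a"]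
      by (simp add: state_def power_add)
    have "calling_output n a s \<phi> C C' x = run (([Call] @ [Call_adjoint]) @ L) x *\<^sub>v (run [Plain K] x *\<^sub>v ?v)"
      unfolding calling_output_def C'_def
      by (rule run_append[OF x _ _ v]) (use K(1) CL in \<open>auto simp: realizes_def\<close>)
    also have "run [Plain K] x = K" using run_single[OF x, of "Plain K"] K(1) by simp
    also have "K *\<^sub>v ?v = kron_vec (?\<xi> x) (\<eta> x)" by (rule K(2)[OF x])
    also have "run (([Call] @ [Call_adjoint]) @ L) x *\<^sub>v kron_vec (?\<xi> x) (\<eta> x) = kron_vec (W x *\<^sub>v ?\<xi> x) (\<eta> x)"
      using CL x \<xi>[OF x] by (simp add: realizes_def state_def)
    finally show ?thesis .
  qed
  have "outcome_prob A (calling_output n a s \<phi> C C' x) = (if \<Phi> x then 1 else 0)" if x: "x \<in> X" for x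
  proof -
    have st: "state (2 ^ n) (W x *\<^sub>v ?\<xi> x)"
      using unitary_mat_state[OF _ \<xi>[OF x]] W(1) x by (auto simp: realizes_def)
    then have "state (2 ^ (n + a)) (calling_output n a s \<phi> C C' x)"
      using kron_vec_state[OF st \<eta>[OF x]] by (simp add: final x power_add)
    moreover have "outcome_prob (kron_mat P (1\<^sub>m (2 ^ a))) (calling_output n a s \<phi> C C' x) = (if \<Psi> x then 1 else 0)"
      using outcome_prob_kron_one[OF projector_carrier[OF assms(4)] _ \<eta>[OF x]] st W(2)[OF x]
      by (simp add: final x state_def)
    ultimately show ?thesis
      using \<Psi>(2) outcome_prob_complement[OF P1] by (auto simp: A_def)
  qed
  then have "decides_with_certainty (calling_output n a s \<phi> C C') X \<Phi> A"
    by (simp add: decides_with_certainty_def)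
  moreover have "Call \<in> set C'" "Call_adjoint \<in> set C'" by (auto simp: C'_def)
  moreover have "A \<in> outcomes (2 ^ (n + a)) (kron_mat P (1\<^sub>m (2 ^ a)))" by (simp add: A_def outcomes_def)
  ultimately show ?thesis using valid projector_one by blast
qed

end
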